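(* Let $E$ be a finite-dimensional Banach space, $C\subseteq E$ an open cone whose closure $\overline C$ is a proper cone, and let $\mu_n,\nu\in\mathcal{P}(C)$ for $n\in\mathbb{N}$. (1) If $\mu_1\le\mu_2\le\cdots\le\nu$ in the stochastic order, then there exists $\mu\in\mathcal{P}(C)$ such that $\mu_n\le\mu\le\nu$ for all $n$ and $\mu_n\to\mu$ weakly. (2) If $\mu_1\ge\mu_2\ge\cdots\ge\nu$ in the stochastic order, then there exists $\mu\in\mathcal{P}(C)$ such that $\mu_n\ge\mu\ge\nu$ for all $n$ and $\mu_n\to\mu$ weakly.
   Context: $E$ is a real finite-dimensional Banach space and $C$ is a nonempty open (convex) cone in $E$; $\overline C$ proper means $\overline C\cap(-\overline C)=\{0\}$. The partial order on $E$ is $x\le y$ iff $y-x\in\overline C$, and $C$ carries its restriction and the topology inherited from $E$. $\mathcal{P}(C)$ denotes the set of all Borel probability measures on $C$ (in this separable setting they are all $\tau$-additive and inner regular). A subset $A\subseteq C$ is an upper set if $x\in A$, $y\in C$ and $x\le y$ imply $y\in A$. The stochastic order on $\mathcal{P}(C)$: $\mu\le\nu$ if $\mu(U)\le\nu(U)$ for each open upper set $U\subseteq C$. Weak convergence $\mu_n\to\mu$ means $\int_C f\,d\mu_n\to\int_C f\,d\mu$ for all bounded continuous $f:C\to\mathbb{R}$. *)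

theory Defs
  imports "HOL-Probability.Probability"
begin

text \<open>
  Scaling is by strictly positive reals: the library predicates \<^const>\<open>cone\<close> and
  \<^const>\<open>convex_cone\<close> force a nonempty cone to contain 0, and an open set that contains 0
  and is closed under scaling is the whole space.
\<close>

definition open_cone :: "'a::real_normed_vector set \<Rightarrow> bool" where
  "open_cone C \<longleftrightarrow> C \<noteq> {} \<and> open C \<and> convex C \<and> (\<forall>x\<in>C. \<forall>t>0. t *\<^sub>R x \<in> C)"

definition proper_cone :: "'a::real_vector set \<Rightarrow> bool" where
  "proper_cone K \<longleftrightarrow> K \<inter> uminus ` K = {0}"

definition cone_le :: "'a::real_normed_vector set \<Rightarrow> 'a \<Rightarrow> 'a \<Rightarrow> bool" where
  "cone_le C x y \<longleftrightarrow> y - x \<in> closure C"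

definition upper_set :: "'a::real_normed_vector set \<Rightarrow> 'a set \<Rightarrow> bool" where
  "upper_set C A \<longleftrightarrow> A \<subseteq> C \<and> (\<forall>x\<in>A. \<forall>y\<in>C. cone_le C x y \<longrightarrow> y \<in> A)"

text \<open>
  The trace on \<open>C\<close> of the Borel sets of the ambient space is the Borel sigma-algebra of the
  subspace \<open>C\<close>; in particular members of the following set have space \<open>C\<close>, so integrals
  with respect to them are integrals over \<open>C\<close>.
\<close>

definition prob_measures_on :: "'a::topological_space set \<Rightarrow> 'a measure set" where
  "prob_measures_on C = {M. prob_space M \<and> sets M = sets (restrict_space borel C)}"

definition stoch_le :: "'a::real_normed_vector set \<Rightarrow> 'a measure \<Rightarrow> 'a measure \<Rightarrow> bool" where
  "stoch_le C M N \<longleftrightarrow>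
     (\<forall>U. openin (top_of_set C) U \<and> upper_set C U \<longrightarrow> measure M U \<le> measure N U)"

definition weakly_converges ::
  "'a::topological_space set \<Rightarrow> (nat \<Rightarrow> 'a measure) \<Rightarrow> 'a measure \<Rightarrow> bool" where
  "weakly_converges C M N \<longleftrightarrow>
     (\<forall>f :: 'a \<Rightarrow> real. continuous_on C f \<and> bounded (f ` C) \<longrightarrow>
        (\<lambda>n. integral\<^sup>L (M n) f) \<longlonglongrightarrow> integral\<^sup>L N f)"

end

theory Submission
  imports Defs
begin

text \<open>
  Fix \<open>e \<in> C\<close>. As the closed cone is proper and the space finite-dimensional, the order intervals
  \<open>[e/n, n e]\<close> are compact, and they exhaust \<open>C\<close>. If \<open>\<alpha> \<le> M n \<le> \<beta>\<close>, then \<open>\<alpha>\<close> controls the mass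
  of \<open>M n\<close> outside the upper set of points above \<open>e/n\<close> and \<open>\<beta>\<close> the mass outside the lower set
  of points below \<open>n e\<close>; so the sequence is tight and has weakly convergent subsequences.
  The stochastic order is closed under weak limits, so any two subsequential limits of a monotone
  sequence dominate each other. They coincide because the open upper sets form an
  intersection-stable generator of the Borel sets. Hence the whole sequence converges.
\<close>

section \<open>Compactness in finite dimension\<close>

text \<open>Since \<open>C\<close> is open, mass could escape to infinity or to the boundary of
  \<open>C\<close>. The inclusion \<open>C + closure C \<subseteq> C\<close> rules out the second: a
  positive multiple of \<open>e\<close> as a lower bound keeps a closed order interval inside
  \<open>C\<close>. Properness enters twice, both times as boundedness of order intervals: it gives
  their compactness, and it makes the intervals around a point shrink to that point, so that open
  upper sets detect all Borel sets. The other obstacle is the direction of the portmanteau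
  inequality. For an open set, weak convergence bounds the limit mass by the liminf of the masses,
  whereas passing \<open>N \<le> M n\<close> to the limit needs a bound from below. A shift of an
  open upper set by a small positive multiple of \<open>e\<close> leaves room for a continuous
  function between the shifted set and the original one, and as the shift tends to zero the set is
  recovered from inside.\<close>

lemma compact_span_Int_cball:
  fixes B :: "'a::real_normed_vector set"
  assumes "finite B"
  shows "compact (span B \<inter> cball 0 r)"
  using assms
proof (induction B arbitrary: r rule: finite_induct)
  case empty
  have "{0::'a} \<inter> cball 0 r = {} \<or> {0::'a} \<inter> cball 0 r = {0}" by auto
  then show ?case by auto
next
  case (insert b B)
  \<comment> \<open>A convergent sequence is bounded, so it stays in one of the compact pieces; this
    is why the induction hypothesis must hold for every radius.\<close>
  have closed: "closed (span B)"
    unfolding closed_sequential_limits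
  proof (intro allI impI, elim conjE)
    fix x and l :: 'a
    assume x: "\<forall>n. x n \<in> span B" and l: "x \<longlonglongrightarrow> l"
    obtain K where "\<And>n. norm (x n) \<le> K"
      using convergent_imp_bounded[OF l] by (auto simp: bounded_iff)
    then have "x n \<in> span B \<inter> cball 0 K" for n using x by auto
    then have "l \<in> span B \<inter> cball 0 K"
      using compact_imp_closed[OF insert.IH] l by (meson closed_sequentially)
    then show "l \<in> span B" by simp
  qed
  show ?case
  proof (cases "b \<in> span B")
    case True
    then show ?thesis using insert.IH by (simp add: span_redundant)
  next
    case False
    define d where "d = infdist b (span B)"
    have ne: "span B \<noteq> {}" using span_zero by blast
    have "d \<noteq> 0" using False in_closed_iff_infdist_zero[OF closed ne] by (simp add: d_def)
    then have d: "d > 0" using infdist_nonneg[of b "span B"] by (simp add: d_def)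
    \<comment> \<open>Dividing by \<open>c\<close> compares \<open>b\<close> with a point of
      \<open>span B\<close>, from which its distance is at least \<open>d\<close>.\<close>
    have coeff: "\<bar>c\<bar> * d \<le> norm (c *\<^sub>R b + y)" if "y \<in> span B" for c y
    proof (cases "c = 0")
      case False
      have "- (inverse c *\<^sub>R y) \<in> span B" using that by (simp add: span_neg span_scale)
      then have "d \<le> dist b (- (inverse c *\<^sub>R y))" unfolding d_def by (rule infdist_le)
      then have "\<bar>c\<bar> * d \<le> \<bar>c\<bar> * norm (b + inverse c *\<^sub>R y)"
        by (intro mult_left_mono) (auto simp: dist_norm)
      also have "\<dots> = norm (c *\<^sub>R (b + inverse c *\<^sub>R y))" by simp
      also have "\<dots> = norm (c *\<^sub>R b + y)" using False by (simp add: scaleR_right_distrib)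
      finally show ?thesis .
    qed auto
    \<comment> \<open>\<open>R\<close> bounds the coefficient of \<open>b\<close>; the remaining
      summand then has norm at most \<open>r + R * norm b\<close>, and the induction hypothesis is
      applied at that larger radius.\<close>
    define R where "R = r / d"
    define I where "I = (\<lambda>p. fst p *\<^sub>R b + snd p) ` ({-R..R} \<times> (span B \<inter> cball 0 (r + R * norm b)))"
    have "compact I"
      unfolding I_def by (intro compact_continuous_image compact_Times insert.IH continuous_intros) auto
    have "span (insert b B) \<inter> cball 0 r \<subseteq> I"
    proof
      fix x assume x: "x \<in> span (insert b B) \<inter> cball 0 r"
      then obtain c where c: "x - c *\<^sub>R b \<in> span B" by (auto simp: span_breakdown_eq)
      define y where "y = x - c *\<^sub>R b"
      have "\<bar>c\<bar> * d \<le> norm x" using coeff[OF c, of c] by simp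
      also have "\<dots> \<le> r" using x by simp
      finally have cR: "\<bar>c\<bar> \<le> R" using d by (simp add: R_def field_simps)
      have "norm y \<le> norm x + \<bar>c\<bar> * norm b" unfolding y_def using norm_triangle_ineq4[of x "c *\<^sub>R b"] by simp
      also have "\<dots> \<le> r + R * norm b" using x cR by (intro add_mono mult_right_mono) auto
      finally have "(c, y) \<in> {-R..R} \<times> (span B \<inter> cball 0 (r + R * norm b))"
        using cR c by (auto simp: y_def)
      then show "x \<in> I" unfolding I_def by (rule rev_image_eqI) (simp add: y_def)
    qed
    moreover have "I \<subseteq> span (insert b B)"
    proof -
      have "span B \<subseteq> span (insert b B)" by (intro span_mono) auto
      then show ?thesis unfolding I_def by (auto intro!: span_add span_scale[OF span_base])
    qed
    ultimately have "span (insert b B) \<inter> cball 0 r = I \<inter> cball 0 r" by auto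
    then show ?thesis using \<open>compact I\<close> by (simp add: compact_Int_closed)
  qed
qed

section \<open>Prokhorov's theorem for sigma-compact sets\<close>

text \<open>Completeness extends \<open>h\<close> over the closure of each bounded piece. Uniqueness
  of continuous extensions makes these agree, and because the pieces are cut out by open balls the
  glued function is locally one of them.\<close>

lemma continuous_extension_closure:
  fixes h :: "'a::real_normed_vector \<Rightarrow> 'b::complete_space"
  assumes uc: "\<And>k::nat. uniformly_continuous_on (T \<inter> ball 0 k) h"
  shows "\<exists>g. continuous_on (closure T) g \<and> (\<forall>x\<in>T. g x = h x)"
proof -
  have "\<forall>k::nat. \<exists>g. continuous_on (closure (T \<inter> ball 0 k)) g \<and> (\<forall>x\<in>T \<inter> ball 0 k. h x = g x)"
    using uniformly_continuous_on_extension_on_closure[OF uc] uniformly_continuous_imp_continuous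
    by metis
  then obtain G :: "nat \<Rightarrow> _" where G: "\<forall>k::nat. continuous_on (closure (T \<inter> ball 0 k)) (G k) \<and> (\<forall>x\<in>T \<inter> ball 0 k. h x = G k x)"
    by (rule choice[THEN exE])
  then have cont: "continuous_on (closure (T \<inter> ball 0 (real k))) (G k)"
    and Gh: "x \<in> T \<inter> ball 0 (real k) \<Longrightarrow> G k x = h x" for k x
    by auto
  have agree: "G k x = G l x" if "k \<le> l" "x \<in> closure (T \<inter> ball 0 (real k))" for k l :: nat and x
  proof -
    have sub: "T \<inter> ball 0 (real k) \<subseteq> T \<inter> ball 0 (real l)" using that by auto
    have "continuous_on (closure (T \<inter> ball 0 (real k))) (G l)"
      using cont[of l] closure_mono[OF sub] continuous_on_subset by blast
    moreover have "\<And>x. x \<in> T \<inter> ball 0 (real k) \<Longrightarrow> h x = G l x"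
      using Gh sub by (metis subsetD)
    moreover obtain g' where g': "\<And>h' x. continuous_on (closure (T \<inter> ball 0 (real k))) h' \<Longrightarrow>
        (\<And>x. x \<in> T \<inter> ball 0 (real k) \<Longrightarrow> h x = h' x) \<Longrightarrow> x \<in> closure (T \<inter> ball 0 (real k)) \<Longrightarrow> h' x = g' x"
      using uniformly_continuous_on_extension_on_closure[OF uc[of k]]
      by (metis closure_subset order_refl)
    ultimately have "G l x = g' x" using that by blast
    moreover have "G k x = g' x" using g'[OF cont[of k]] Gh[of _ k] that by fastforce
    ultimately show ?thesis by simp
  qed
  \<comment> \<open>\<open>Suc\<close> makes the bound strict: the open ball is a neighbourhood of
    \<open>x\<close>, and within it \<open>g\<close> agrees on \<open>closure T\<close> with the
    single function \<open>G (K x)\<close>.\<close>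
  define K where "K x = Suc (nat \<lceil>norm x\<rceil>)" for x :: 'a
  have K: "norm x < real (K x)" for x unfolding K_def by linarith
  define g where "g x = G (K x) x" for x
  have cl: "closure T \<inter> ball 0 (real k) \<subseteq> closure (T \<inter> ball 0 (real k))" for k :: nat
    using open_Int_closure_subset[OF open_ball, of 0 "real k" T] by (simp add: Int_commute)
  have gG: "g x = G k x" if "x \<in> closure T" "norm x < real k" for x and k :: nat
  proof -
    have a: "x \<in> closure (T \<inter> ball 0 (real j))" if "norm x < real j" for j :: nat
      using \<open>x \<in> closure T\<close> that by (intro subsetD[OF cl]) simp
    show ?thesis unfolding g_def
      using agree[OF _ a[OF K]] agree[OF _ a[OF that(2)]] by (metis nat_le_linear)
  qed
  show ?thesis
  proof (intro exI[of _ g] conjI ballI)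
    show "continuous_on (closure T) g"
      unfolding continuous_on_eq_continuous_within
    proof
      fix x assume x: "x \<in> closure T"
      have "continuous_on (closure T \<inter> ball 0 (real (K x))) (G (K x))"
        using cont cl continuous_on_subset by blast
      then have "continuous_on (closure T \<inter> ball 0 (real (K x))) g"
        by (rule continuous_on_eq) (auto simp: gG)
      then have "continuous (at x within closure T \<inter> ball 0 (real (K x))) g"
        using x K[of x] by (simp add: continuous_on_eq_continuous_within)
      then show "continuous (at x within closure T) g"
        using at_within_nhd[of x "ball 0 (real (K x))" "closure T \<inter> ball 0 (real (K x))" "closure T"] K[of x]
        by (simp add: Int_assoc)
    qed
    show "g x = h x" if "x \<in> T" for x
      using gG[of x "K x"] K[of x] that closure_subset Gh[of x "K x"] by auto
  qed
qed

section \<open>Coding a sigma-compact set by real numbers\<close>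

text \<open>With digits 0 and 1 in base 3, all digits after the first difference together weigh at
  most half as much as that difference and cannot cancel it. In base 2 they could.\<close>

lemma ternary_digit_separation:
  fixes a b :: "nat \<Rightarrow> bool"
  assumes "i \<le> m" "a i \<noteq> b i"
  shows "(1/3) ^ Suc m / 2 \<le> \<bar>(\<Sum>j. (1/3) ^ Suc j * of_bool (a j)) - (\<Sum>j. (1/3) ^ Suc j * of_bool (b j) :: real)\<bar>"
proof -
  have geo: "summable (\<lambda>j. (1/3::real) ^ Suc j)" by (simp add: summable_geometric)
  have dig: "summable (\<lambda>j. (1/3::real) ^ Suc j * of_bool (c j))" for c
    by (rule summable_comparison_test'[OF geo, of 0]) auto
  define c :: "nat \<Rightarrow> real" where "c j = of_bool (a j) - of_bool (b j)" for j
  define f where "f j = (1/3) ^ Suc j * c j" for j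
  have f_eq: "f j = (1/3) ^ Suc j * of_bool (a j) - (1/3) ^ Suc j * of_bool (b j)" for j
    by (simp add: f_def c_def right_diff_distrib)
  have sf: "summable f" unfolding f_eq by (intro summable_diff dig)
  have eq: "(\<Sum>j. (1/3) ^ Suc j * of_bool (a j)) - (\<Sum>j. (1/3) ^ Suc j * of_bool (b j) :: real) = suminf f"
    unfolding f_eq by (intro suminf_diff dig)
  have cle: "\<bar>c j\<bar> \<le> 1" for j by (simp add: c_def)
  define l where "l = (LEAST j. a j \<noteq> b j)"
  have l: "a l \<noteq> b l" and lm: "l \<le> m"
    unfolding l_def using LeastI[of "\<lambda>j. a j \<noteq> b j" i] Least_le[of "\<lambda>j. a j \<noteq> b j" i] assms by auto
  have "f j = 0" if "j < l" for j
    using not_less_Least[of j "\<lambda>j. a j \<noteq> b j"] that by (simp add: f_def c_def l_def)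
  then have "suminf f = (\<Sum>j. f (j + Suc l)) + f l"
    using suminf_split_initial_segment[OF sf, of "Suc l"] by simp
  moreover have "\<bar>f l\<bar> = (1/3) ^ Suc l"
    using l by (auto simp: f_def c_def abs_mult power_abs)
  moreover have "\<bar>\<Sum>j. f (j + Suc l)\<bar> \<le> (1/3) ^ Suc l / 2"
  proof -
    have s: "(\<lambda>j. (1/3::real) ^ Suc (Suc l) * (1/3) ^ j) sums ((1/3) ^ Suc (Suc l) * (1 / (1 - 1/3)))"
      by (intro sums_mult geometric_sums) simp
    have "norm (f (j + Suc l)) \<le> (1/3::real) ^ Suc (Suc l) * (1/3) ^ j" for j
      using cle[of "j + Suc l"] by (auto simp: f_def abs_mult power_add intro: mult_left_le)
    then have "norm (\<Sum>j. f (j + Suc l)) \<le> (\<Sum>j. (1/3::real) ^ Suc (Suc l) * (1/3) ^ j)"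
      by (rule norm_suminf_le) (use s in \<open>simp add: sums_iff\<close>)
    also have "\<dots> = (1/3) ^ Suc l / 2" using sums_unique[OF s] by simp
    finally show ?thesis by simp
  qed
  moreover have "(1/3::real) ^ Suc m \<le> (1/3) ^ Suc l" using lm by (intro power_decreasing) auto
  ultimately show ?thesis unfolding eq by linarith
qed

lemma sigma_compact_nets:
  fixes K :: "nat \<Rightarrow> 'a::metric_space set"
  assumes "\<And>k. compact (K k)"
  obtains F :: "nat \<Rightarrow> nat \<Rightarrow> 'a set"
    where "\<And>k m. finite (F k m)" "\<And>k m. K k \<subseteq> (\<Union>z\<in>F k m. ball z (1 / Suc m))"
proof -
  have "\<exists>F. finite F \<and> K k \<subseteq> (\<Union>z\<in>F. ball z (1 / real (Suc m)))" for k m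
    using assms[of k] unfolding compact_eq_totally_bounded
    by (metis of_nat_0_less_iff zero_less_Suc zero_less_divide_1_iff)
  then show thesis using that by metis
qed

text \<open>
  Reduces weak compactness on \<open>C\<close> to Helly's selection theorem on the real line. The fractional part of
  the code \<open>s x\<close> lists in base 3 which sets of a countable family of small balls contain \<open>x\<close>; its
  integer part is twice the index of the first \<open>K k\<close> containing \<open>x\<close>. On bounded sets of codes
  finitely many digits determine \<open>x\<close> up to any given error, so decoding is locally uniformly
  continuous and extends to the closure of the set of codes.
\<close>

lemma sigma_compact_real_code:
  fixes K :: "nat \<Rightarrow> 'a::complete_space set"
  assumes compact: "\<And>k. compact (K k)" and inc: "incseq K"
  defines "C \<equiv> \<Union>k. K k"
  obtains s :: "'a \<Rightarrow> real" and g :: "real \<Rightarrow> 'a"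
  where "s \<in> borel_measurable borel"
    and "\<And>k. s ` K k \<subseteq> {0..2 * real k + 1}"
    and "continuous_on (closure (s ` C)) g"
    and "\<And>x. x \<in> C \<Longrightarrow> g (s x) = x"
    and "g ` closure (s ` C) \<subseteq> C"
proof -
  obtain F :: "nat \<Rightarrow> nat \<Rightarrow> 'a set" where finF: "\<And>k m. finite (F k m)"
    and F: "\<And>k m. K k \<subseteq> (\<Union>z\<in>F k m. ball z (1 / Suc m))"
    using sigma_compact_nets[of K] compact by blast
  \<comment> \<open>The empty set is included only to make the family nonempty, so that it is the
    range of a sequence.\<close>
  define \<A> where "\<A> = insert {} (\<Union>k m. (\<lambda>z. ball z (1 / Suc m)) ` F k m)"
  have "countable \<A>" unfolding \<A>_def
    by (intro countable_insert countable_UN[OF countableI_type] countable_image countable_finite finF)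
  moreover have "\<A> \<noteq> {}" by (simp add: \<A>_def)
  ultimately obtain A :: "nat \<Rightarrow> 'a set" where A: "range A = \<A>"
    using uncountable_def by (metis)
  have openA: "open (A j)" for j
  proof -
    have "A j \<in> \<A>" using A by auto
    then show ?thesis by (auto simp: \<A>_def)
  qed
  define s0 :: "'a \<Rightarrow> real" where "s0 x = (\<Sum>j. (1/3) ^ Suc j * of_bool (x \<in> A j))" for x
  define N where "N x = (LEAST k. x \<in> K k)" for x
  \<comment> \<open>As \<open>s0\<close> takes values in \<open>[0, 1/2]\<close>, the factor 2 keeps
    codes with different \<open>N\<close> at least 3/2 apart.\<close>
  define s where "s x = 2 * real (N x) + s0 x" for x
  have geo: "(\<lambda>j. (1/3::real) ^ Suc j) sums (1/2)"
    using sums_mult[OF geometric_sums[of "1/3::real"], of "1/3"] by simp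
  have dig: "summable (\<lambda>j. (1/3::real) ^ Suc j * of_bool (P j))" for P
    by (rule summable_comparison_test'[OF sums_summable[OF geo], of 0]) auto
  have s0: "0 \<le> s0 x" "s0 x \<le> 1/2" for x
  proof -
    show "0 \<le> s0 x" unfolding s0_def by (intro suminf_nonneg dig) auto
    have "s0 x \<le> (\<Sum>j. (1/3::real) ^ Suc j)" unfolding s0_def
      by (intro suminf_le dig sums_summable[OF geo]) auto
    then show "s0 x \<le> 1/2" using sums_unique[OF geo] by simp
  qed
  have NK: "x \<in> K k" if "x \<in> C" "N x \<le> k" for x k
  proof -
    have "x \<in> K (N x)" using \<open>x \<in> C\<close> unfolding N_def C_def by (auto intro: LeastI)
    then show ?thesis using incseqD[OF inc that(2)] by auto
  qed
  have Nle: "N x \<le> k" if "x \<in> K k" for x k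
    unfolding N_def using that by (rule Least_le)
  have [measurable]: "K k \<in> sets borel" "A j \<in> sets borel" for k j
    using compact openA by (auto intro: borel_closed compact_imp_closed)
  have meas: "s \<in> borel_measurable borel"
  proof -
    have "(\<lambda>x. of_bool (x \<in> A j)) = (indicator (A j) :: 'a \<Rightarrow> real)" for j
      by (auto simp: indicator_def)
    then have "(\<lambda>x. of_bool (x \<in> A j) :: real) \<in> borel_measurable borel" for j by simp
    then have "s0 \<in> borel_measurable borel" unfolding s0_def by measurable
    moreover have "N \<in> borel \<rightarrow>\<^sub>M count_space UNIV" unfolding N_def by measurable
    ultimately show ?thesis unfolding s_def by measurable
  qed
  have sK: "s ` K k \<subseteq> {0..2 * real k + 1}" for k
  proof safe
    fix x assume "x \<in> K k"
    then show "s x \<in> {0..2 * real k + 1}" using Nle[of x k] s0[of x] by (auto simp: s_def)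
  qed
  have modulus: "\<exists>\<delta>>0. \<forall>x\<in>K k. \<forall>y\<in>K k. \<bar>s x - s y\<bar> < \<delta> \<longrightarrow> dist x y < \<epsilon>" if "\<epsilon> > 0" for k \<epsilon>
  proof -
    obtain m :: nat where m: "2 / \<epsilon> < real m" using reals_Archimedean2 by blast
    have "2 / real (Suc m) < \<epsilon>"
    proof -
      have "2 / \<epsilon> < real (Suc m)" using m by simp
      then show ?thesis using \<open>\<epsilon> > 0\<close> by (simp add: field_simps)
    qed
    \<comment> \<open>Only the finitely many balls covering \<open>K k\<close> matter at this scale,
      so digits up to some \<open>J\<close> decide which of them contain a point. Two points sharing
      such a ball are closer than \<open>2 / Suc m\<close>.\<close>
    have "(\<lambda>z. ball z (1 / Suc m)) ` F k m \<subseteq> range A" unfolding A \<A>_def by blast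
    then obtain I where I: "finite I" "(\<lambda>z. ball z (1 / Suc m)) ` F k m = A ` I"
      using finite_subset_image[of "(\<lambda>z. ball z (1 / Suc m)) ` F k m" A UNIV] finF by auto
    obtain J where J: "I \<subseteq> {..J}" using I(1) finite_nat_iff_bounded_le[of I] by auto
    define \<delta> :: real where "\<delta> = (1/3) ^ Suc J / 2"
    have \<delta>: "\<delta> > 0" "\<delta> < 1"
    proof -
      have "(1/3::real) ^ Suc J \<le> 1" by (rule power_le_one) auto
      then show "\<delta> < 1" unfolding \<delta>_def by linarith
    qed (simp add: \<delta>_def)
    have "dist x y < \<epsilon>" if x: "x \<in> K k" and y: "y \<in> K k" and d: "\<bar>s x - s y\<bar> < \<delta>" for x y
    proof -
      have "\<bar>2 * real (N x) - 2 * real (N y)\<bar> < 2"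
        using d \<delta> s0[of x] s0[of y] unfolding s_def by linarith
      then have "N x = N y" by linarith
      then have d0: "\<bar>s0 x - s0 y\<bar> < \<delta>" using d by (simp add: s_def)
      have same: "x \<in> A i \<longleftrightarrow> y \<in> A i" if "i \<le> J" for i
        using ternary_digit_separation[OF that, of "\<lambda>j. x \<in> A j" "\<lambda>j. y \<in> A j"] d0
        unfolding s0_def \<delta>_def by linarith
      obtain z where z: "z \<in> F k m" "x \<in> ball z (1 / Suc m)" using F x by blast
      then obtain i where i: "i \<in> I" "ball z (1 / Suc m) = A i" using I(2) by blast
      then have "y \<in> ball z (1 / Suc m)" using same[of i] z J by auto
      then have "dist x y < 1 / Suc m + 1 / Suc m"
        using z(2) dist_triangle_less_add[of x z "1 / Suc m" y "1 / Suc m"] by (simp add: dist_commute)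
      then show ?thesis using \<open>2 / real (Suc m) < \<epsilon>\<close> by simp
    qed
    then show ?thesis using \<delta> by blast
  qed
  have inj: "inj_on s C"
  proof (rule inj_onI, rule ccontr)
    fix x y assume xy: "x \<in> C" "y \<in> C" "s x = s y" "x \<noteq> y"
    define k where "k = max (N x) (N y)"
    have "x \<in> K k" "y \<in> K k" using NK xy by (auto simp: k_def)
    then show False using modulus[of "dist x y" k] xy by fastforce
  qed
  define h where "h = inv_into C s"
  have h: "h (s x) = x" if "x \<in> C" for x using inj that by (simp add: h_def)
  \<comment> \<open>A code below \<open>k\<close> has \<open>2 * N x < k\<close>, so bounded sets of
    codes come from a single compact \<open>K k\<close>, where \<open>modulus\<close>
    applies.\<close>
  have sub: "\<exists>x\<in>K k. t = s x" if t: "t \<in> s ` C \<inter> ball 0 (real k)" for t and k :: nat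
  proof -
    obtain x where x: "x \<in> C" "t = s x" using t by auto
    have "N x \<le> k" using t x s0[of x] by (auto simp: s_def)
    then show ?thesis using NK x by blast
  qed
  have "uniformly_continuous_on (s ` C \<inter> ball 0 (real k)) h" for k
    unfolding uniformly_continuous_on_def
  proof (intro allI impI)
    fix \<epsilon> :: real assume "\<epsilon> > 0"
    then obtain \<delta> where \<delta>: "\<delta> > 0" "\<And>x y. x\<in>K k \<Longrightarrow> y\<in>K k \<Longrightarrow> \<bar>s x - s y\<bar> < \<delta> \<Longrightarrow> dist x y < \<epsilon>"
      using modulus by meson
    have "dist (h t') (h t) < \<epsilon>"
      if tt: "t \<in> s ` C \<inter> ball 0 (real k)" "t' \<in> s ` C \<inter> ball 0 (real k)" and d: "dist t' t < \<delta>" for t t'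
    proof -
      obtain x y where "x \<in> K k" "t' = s x" "y \<in> K k" "t = s y" using sub tt by blast
      moreover from this have "h (s x) = x" "h (s y) = y" using h by (auto simp: C_def)
      ultimately show ?thesis using d \<delta>(2)[of x y] by (simp add: dist_real_def)
    qed
    then show "\<exists>\<delta>>0. \<forall>t\<in>s ` C \<inter> ball 0 (real k). \<forall>t'\<in>s ` C \<inter> ball 0 (real k).
        dist t' t < \<delta> \<longrightarrow> dist (h t') (h t) < \<epsilon>" using \<delta>(1) by blast
  qed
  then have "\<exists>g. continuous_on (closure (s ` C)) g \<and> (\<forall>t\<in>s ` C. g t = h t)"
    by (rule continuous_extension_closure)
  then obtain g where g: "continuous_on (closure (s ` C)) g" "\<And>t. t \<in> s ` C \<Longrightarrow> g t = h t"
    by blast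
  have gs: "g (s x) = x" if "x \<in> C" for x using g(2) h that by simp
  have img: "g ` closure (s ` C) \<subseteq> C"
  proof safe
    fix t assume t: "t \<in> closure (s ` C)"
    obtain k :: nat where k: "\<bar>t\<bar> < real k" using reals_Archimedean2 by blast
    have tk: "t \<in> closure (s ` C \<inter> ball 0 (real k))"
      using open_Int_closure_subset[OF open_ball, of 0 "real k" "s ` C"] t k by (auto simp: Int_commute)
    \<comment> \<open>Closedness of \<open>K k\<close> prevents the decoding of limit codes from
      leaving \<open>C\<close>, which itself need not be closed.\<close>
    have "g ` closure (s ` C \<inter> ball 0 (real k)) \<subseteq> K k"
    proof (rule image_closure_subset)
      show "continuous_on (closure (s ` C \<inter> ball 0 (real k))) g"
        by (rule continuous_on_subset[OF g(1)]) (intro closure_mono, auto)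
      show "closed (K k)" using compact by (rule compact_imp_closed)
      show "g ` (s ` C \<inter> ball 0 (real k)) \<subseteq> K k"
      proof (rule image_subsetI)
        fix t assume "t \<in> s ` C \<inter> ball 0 (real k)"
        then obtain x where x: "x \<in> K k" "t = s x" using sub by blast
        then have "x \<in> C" by (auto simp: C_def)
        then show "g t \<in> K k" using gs x by simp
      qed
    qed
    then show "g t \<in> C" using tk by (auto simp: C_def)
  qed
  show thesis by (rule that[OF meas sK g(1) gs img])
qed

lemma prob_measures_onD:
  assumes "M \<in> prob_measures_on C"
  shows "prob_space M" "sets M = sets (restrict_space borel C)" "space M = C"
  using assms sets_eq_imp_space_eq[of M "restrict_space borel C"]
  by (auto simp: prob_measures_on_def space_restrict_space)

lemma integrable_bounded_continuous:
  fixes f :: "'a::topological_space \<Rightarrow> real"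
  assumes "M \<in> prob_measures_on C" "continuous_on C f" "\<And>x. x \<in> C \<Longrightarrow> \<bar>f x\<bar> \<le> B"
  shows "integrable M f"
proof -
  interpret prob_space M using assms(1) by (rule prob_measures_onD)
  have "f \<in> borel_measurable M"
    using borel_measurable_continuous_on_restrict[OF assms(2)] prob_measures_onD(2)[OF assms(1)]
    by (simp cong: measurable_cong_sets)
  then show ?thesis using assms(3) prob_measures_onD(3)[OF assms(1)]
    by (intro integrable_const_bound[of _ B]) auto
qed

text \<open>The coding map \<open>s\<close> is merely measurable, which suffices to push the
  measures to the line. Continuity is needed only for the decoding \<open>g\<close>, since a test
  function \<open>f\<close> on \<open>C\<close> is transported as \<open>f \<circ> g\<close>. The
  limit on the line is pushed back by \<open>g\<close>.\<close>

theorem Prokhorov_sigma_compact: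
  fixes K :: "nat \<Rightarrow> 'a::complete_space set"
  assumes compact: "\<And>k. compact (K k)" and inc: "incseq K" and C: "C = (\<Union>k. K k)"
    and M: "\<And>n::nat. M n \<in> prob_measures_on C"
    and tight: "\<And>\<epsilon>. \<epsilon> > 0 \<Longrightarrow> \<exists>k. \<forall>n. measure (M n) (K k) > 1 - \<epsilon>"
  shows "\<exists>r \<mu>. strict_mono r \<and> \<mu> \<in> prob_measures_on C \<and> weakly_converges C (M \<circ> r) \<mu>"
proof -
  obtain s :: "'a \<Rightarrow> real" and g where s[measurable]: "s \<in> borel_measurable borel"
    and sK: "\<And>k. s ` K k \<subseteq> {0..2 * real k + 1}"
    and gcont: "continuous_on (closure (s ` C)) g"
    and gs: "\<And>x. x \<in> C \<Longrightarrow> g (s x) = x" and gC: "g ` closure (s ` C) \<subseteq> C"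
    using sigma_compact_real_code[of K, OF compact inc] unfolding C by blast
  interpret M: prob_space "M n" for n using M by (rule prob_measures_onD)
  note setsM = prob_measures_onD(2)[OF M] and spaceM = prob_measures_onD(3)[OF M]
  have sM[measurable]: "s \<in> borel_measurable (M n)" for n
    using measurable_restrict_space1[OF s, of C] setsM by (simp cong: measurable_cong_sets)
  have KM[measurable]: "K k \<in> sets (M n)" for k n
    using compact[of k] unfolding setsM sets_restrict_space C
    by (intro image_eqI[of _ _ "K k"]) (auto intro: borel_closed compact_imp_closed)
  define D where "D n = distr (M n) borel s" for n
  have rd: "real_distribution (D n)" for n unfolding D_def by (rule M.real_distribution_distr) simp
  have "tight D" unfolding tight_def
  proof (intro conjI allI impI rd)
    fix \<epsilon> :: real assume "\<epsilon> > 0"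
    then obtain k where k: "\<And>n. measure (M n) (K k) > 1 - \<epsilon>" using tight by blast
    \<comment> \<open>The left end is -1 because tightness on the line uses half-open intervals and
      the code 0 must be included.\<close>
    have "measure (D n) {-1<..2 * real k + 1} > 1 - \<epsilon>" for n
    proof -
      have "measure (M n) (K k) \<le> measure (M n) (s -` {-1<..2 * real k + 1} \<inter> space (M n))"
        using sK[of k] by (intro M.finite_measure_mono) (fastforce simp: spaceM C, measurable)
      then show ?thesis using k[of n] by (simp add: D_def measure_distr)
    qed
    then show "\<exists>a b. a < b \<and> (\<forall>n. measure (D n) {a<..b} > 1 - \<epsilon>)"
      by (intro exI[of _ "-1"] exI[of _ "2 * real k + 1"]) auto
  qed
  then obtain r L where r: "strict_mono (r :: nat \<Rightarrow> nat)" and L: "real_distribution L"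
    and wc: "weak_conv_m (D \<circ> id \<circ> r) L"
    using tight_imp_convergent_subsubsequence[of D id] by (auto simp: strict_mono_id)
  interpret L: real_distribution L by fact
  have rd': "real_distribution ((D \<circ> id \<circ> r) n)" for n using rd by simp
  have conv: "(\<lambda>n. integral\<^sup>L (D (r n)) f) \<longlonglongrightarrow> integral\<^sup>L L f"
    if "continuous_on UNIV f" "\<And>x. \<bar>f x\<bar> \<le> B" for f :: "real \<Rightarrow> real" and B
    using weak_conv_imp_integral_bdd_continuous_conv[OF rd' L wc, of f B] that
    by (simp add: continuous_on_eq_continuous_at)
  have intD: "integral\<^sup>L (D n) f = integral\<^sup>L (M n) (\<lambda>x. f (s x))"
    if "continuous_on UNIV f" for f :: "real \<Rightarrow> real" and n
    unfolding D_def by (rule integral_distr[OF sM borel_measurable_continuous_onI[OF that]])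
  define S where "S = closure (s ` C)"
  have sS: "s x \<in> S" if "x \<in> C" for x unfolding S_def using that closure_subset[of "s ` C"] by auto
  have "C \<noteq> {}" using M.not_empty[of 0] by (simp add: spaceM)
  then obtain e where e: "e \<in> C" by blast
  then have "S \<noteq> {}" using sS by blast
  have "closed S" by (simp add: S_def)
  \<comment> \<open>The truncated distance to \<open>S\<close> is a bounded continuous test function
    vanishing on all codes, so its integral against the limit is zero.\<close>
  have AES: "AE t in L. t \<in> S"
  proof -
    define f where "f t = min 1 (infdist t S)" for t
    have fc: "continuous_on UNIV f" unfolding f_def by (intro continuous_intros)
    have f01: "0 \<le> f t" "f t \<le> 1" for t by (auto simp: f_def infdist_nonneg)
    have "integral\<^sup>L (D n) f = 0" for n
      unfolding intD[OF fc] using sS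
      by (intro Bochner_Integration.integral_eq_zero_AE AE_I2) (auto simp: f_def spaceM)
    then have "(\<lambda>n. 0) \<longlonglongrightarrow> integral\<^sup>L L f" using conv[OF fc, of 1] f01 by simp
    then have "integral\<^sup>L L f = 0" using LIMSEQ_const_iff by metis
    moreover have "integrable L f" using f01 borel_measurable_continuous_onI[OF fc]
      by (intro L.integrable_const_bound[of _ 1]) auto
    ultimately have "AE t in L. f t = 0"
      using integral_nonneg_eq_0_iff_AE[of L f] f01 by auto
    then show ?thesis
      by eventually_elim (use \<open>closed S\<close> \<open>S \<noteq> {}\<close> in \<open>auto simp: f_def in_closed_iff_infdist_zero min_def split: if_splits\<close>)
  qed
  \<comment> \<open>The value \<open>e\<close> off \<open>S\<close> is taken on an
    \<open>L\<close>-null set; it makes the map total with values in \<open>C\<close>.\<close>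
  define g' where "g' t = (if t \<in> S then g t else e)" for t
  have [measurable]: "S \<in> sets borel" using \<open>closed S\<close> by simp
  have g'C: "g' t \<in> C" for t using gC e by (auto simp: g'_def S_def)
  have "g' \<in> borel_measurable borel"
    unfolding g'_def using gcont
    by (intro borel_measurable_continuous_on_if) (auto simp: S_def)
  then have g'm: "g' \<in> L \<rightarrow>\<^sub>M restrict_space borel C"
    using g'C by (intro measurable_restrict_space2) auto
  define \<mu> where "\<mu> = distr L (restrict_space borel C) g'"
  have "\<mu> \<in> prob_measures_on C" unfolding prob_measures_on_def \<mu>_def
    using L.prob_space_distr[OF g'm] by simp
  moreover have "weakly_converges C (M \<circ> r) \<mu>"
    unfolding weakly_converges_def
  proof (intro allI impI, elim conjE)
    fix f :: "'a \<Rightarrow> real" assume f: "continuous_on C f" "bounded (f ` C)"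
    then obtain B where B: "\<And>x. x \<in> C \<Longrightarrow> \<bar>f x\<bar> \<le> B" by (auto simp: bounded_iff)
    then have "0 \<le> B" using e abs_ge_zero order_trans by blast
    have "continuous_on S (\<lambda>t. f (g t))"
      using gcont gC f(1) unfolding S_def
      by (intro continuous_on_compose2[OF f(1) gcont]) auto
    \<comment> \<open>Weak convergence on the line tests against functions on all of the line, while
      \<open>f \<circ> g\<close> lives on the closed set \<open>S\<close>; the Tietze extension
      keeps the bound \<open>B\<close>.\<close>
    then obtain G where G: "continuous_on UNIV G" "\<And>t. t \<in> S \<Longrightarrow> G t = f (g t)" "\<And>t. \<bar>G t\<bar> \<le> B"
      using Tietze[of S "\<lambda>t. f (g t)" UNIV B] \<open>closed S\<close> \<open>0 \<le> B\<close> B gC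
      by (auto simp: S_def image_subset_iff)
    have "integral\<^sup>L (M n) f = integral\<^sup>L (D n) G" for n
      unfolding intD[OF G(1)] by (intro Bochner_Integration.integral_cong) (auto simp: spaceM G(2) sS gs)
    moreover have "integral\<^sup>L \<mu> f = integral\<^sup>L L G"
    proof -
      have "integral\<^sup>L \<mu> f = integral\<^sup>L L (\<lambda>t. f (g' t))" unfolding \<mu>_def
        by (rule integral_distr[OF g'm borel_measurable_continuous_on_restrict[OF f(1)]])
      also have "\<dots> = integral\<^sup>L L G"
      proof (rule integral_cong_AE)
        show "(\<lambda>t. f (g' t)) \<in> borel_measurable L"
          by (rule measurable_compose[OF g'm borel_measurable_continuous_on_restrict[OF f(1)]])
        show "G \<in> borel_measurable L" using borel_measurable_continuous_onI[OF G(1)] by simp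
        show "AE t in L. f (g' t) = G t" using AES by eventually_elim (simp add: g'_def G(2))
      qed
      finally show ?thesis .
    qed
    ultimately show "(\<lambda>n. integral\<^sup>L ((M \<circ> r) n) f) \<longlonglongrightarrow> integral\<^sup>L \<mu> f"
      using conv[OF G(1,3)] by simp
  qed
  ultimately show ?thesis using r by blast
qed

section \<open>The order of a proper open cone\<close>

locale proper_open_cone =
  fixes C :: "'a::banach set"
  assumes finite_dimensional: "\<exists>B :: 'a set. finite B \<and> span B = UNIV"
    and open_cone: "open_cone C"
    and proper: "proper_cone (closure C)"
begin

lemma open_C: "open C" and convex_C: "convex C" and C_nonempty: "C \<noteq> {}"
  and scale_C: "x \<in> C \<Longrightarrow> t > 0 \<Longrightarrow> t *\<^sub>R x \<in> C"
  using open_cone by (auto simp: open_cone_def)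

definition e :: 'a where "e = (SOME x. x \<in> C)"

lemma e_in_C: "e \<in> C"
  unfolding e_def using C_nonempty by (auto intro: someI)

lemma add_C:
  assumes "x \<in> C" "y \<in> C"
  shows "x + y \<in> C"
proof -
  have "(1/2) *\<^sub>R x + (1/2) *\<^sub>R y \<in> C" using convexD[OF convex_C assms, of "1/2" "1/2"] by simp
  then have "2 *\<^sub>R ((1/2) *\<^sub>R x + (1/2) *\<^sub>R y) \<in> C" by (rule scale_C) simp
  then show ?thesis by (simp add: scaleR_right_distrib)
qed

text \<open>The error in approximating \<open>y\<close> by a point of \<open>C\<close> is absorbed
  into \<open>x\<close>, around which \<open>C\<close> contains a ball.\<close>

lemma add_C_closure:
  assumes "x \<in> C" "y \<in> closure C"
  shows "x + y \<in> C"
proof -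
  obtain d where d: "d > 0" "ball x d \<subseteq> C" using open_C assms(1) open_contains_ball by blast
  obtain z where z: "z \<in> C" "dist z y < d" using assms(2) d(1) by (auto simp: closure_approachable)
  have "x + (y - z) \<in> ball x d" using z(2) by (simp add: dist_norm norm_minus_commute)
  then have "x + (y - z) + z \<in> C" using d(2) z(1) by (intro add_C[of "x + (y - z)"]) auto
  then show ?thesis by simp
qed

lemma closure_add:
  assumes "x \<in> closure C" "y \<in> closure C"
  shows "x + y \<in> closure C"
proof -
  obtain u v where "\<And>n::nat. u n \<in> C" "u \<longlonglongrightarrow> x" "\<And>n::nat. v n \<in> C" "v \<longlonglongrightarrow> y"
    using assms by (auto simp: closure_sequential)
  then show ?thesis using add_C tendsto_add[of u x sequentially v y]
    by (auto simp: closure_sequential intro!: exI[of _ "\<lambda>n. u n + v n"])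
qed

lemma closure_scale:
  assumes "x \<in> closure C" "t > 0"
  shows "t *\<^sub>R x \<in> closure C"
proof -
  have "(*\<^sub>R) t ` C \<subseteq> C" using assms(2) scale_C by auto
  then have "(*\<^sub>R) t ` closure C \<subseteq> closure C"
    using closure_scaleR[of t C] closure_mono by metis
  then show ?thesis using assms(1) by auto
qed

lemma C_subset_closure: "x \<in> C \<Longrightarrow> x \<in> closure C"
  using closure_subset by blast

lemma compact_cball: "compact (cball (0::'a) r)"
proof -
  obtain B :: "'a set" where "finite B" "span B = UNIV" using finite_dimensional by blast
  then show ?thesis using compact_span_Int_cball[of B r] by simp
qed

text \<open>For an unbounded sequence of such \<open>z\<close>, normalise: a limit direction lies in
  the closed cone, and so does its negative, because \<open>y\<close> disappears when divided by
  \<open>norm (z n)\<close>. Properness excludes a unit vector of this kind.\<close>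

lemma bounded_interval_zero: "bounded {z \<in> closure C. y - z \<in> closure C}"
proof (rule ccontr)
  assume "\<not> ?thesis"
  then have "\<forall>n. \<exists>z. z \<in> closure C \<and> y - z \<in> closure C \<and> norm z > real (Suc n)"
    unfolding bounded_iff by (metis (no_types, lifting) linorder_not_le mem_Collect_eq)
  then obtain z where "\<forall>n. z n \<in> closure C \<and> y - z n \<in> closure C \<and> norm (z n) > real (Suc n)"
    by (rule choice[THEN exE]) blast
  then have z: "\<And>n. z n \<in> closure C" "\<And>n. y - z n \<in> closure C" "\<And>n. norm (z n) > real (Suc n)"
    by auto
  have pos: "norm (z n) > 0" for n using z(3)[of n] by linarith
  define u where "u n = z n /\<^sub>R norm (z n)" for n
  have nu: "norm (u n) = 1" for n using pos[of n] by (simp add: u_def)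
  then have "u n \<in> cball 0 1" for n by simp
  then obtain l r where l: "strict_mono (r :: nat \<Rightarrow> nat)" "(u \<circ> r) \<longlonglongrightarrow> l"
    using compact_cball[of 1] unfolding compact_def by meson
  have "(\<lambda>n. norm ((u \<circ> r) n)) \<longlonglongrightarrow> norm l" using l(2) by (rule tendsto_norm)
  then have "norm l = 1" by (simp add: nu LIMSEQ_const_iff)
  have "u n \<in> closure C" for n unfolding u_def using pos z(1) by (intro closure_scale) auto
  then have l_cl: "l \<in> closure C"
    using closed_sequentially[OF closed_closure, of "u \<circ> r"] l(2) by auto
  have "inverse (norm (z n)) *\<^sub>R (y - z n) \<in> closure C" for n using pos z(2) by (intro closure_scale) auto
  then have ym: "inverse (norm (z n)) *\<^sub>R y - u n \<in> closure C" for n by (simp add: u_def scaleR_right_diff_distrib)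
  have "(\<lambda>n. inverse (norm (z n))) \<longlonglongrightarrow> 0"
  proof (rule tendsto_sandwich[OF _ _ tendsto_const LIMSEQ_inverse_real_of_nat])
    show "\<forall>\<^sub>F n in sequentially. inverse (norm (z n)) \<le> inverse (real (Suc n))"
      using z(3) by (intro always_eventually allI le_imp_inverse_le) (auto intro: less_imp_le)
  qed (use pos in auto)
  then have "(\<lambda>n. inverse (norm (z (r n))) *\<^sub>R y - u (r n)) \<longlonglongrightarrow> 0 *\<^sub>R y - l"
    using l LIMSEQ_subseq_LIMSEQ[OF _ l(1)] by (intro tendsto_intros) (auto simp: comp_def)
  then have "- l \<in> closure C"
    using closed_sequentially[OF closed_closure, of "\<lambda>n. inverse (norm (z (r n))) *\<^sub>R y - u (r n)" C "-l"] ym by auto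
  then have "l \<in> closure C \<inter> uminus ` closure C" using l_cl by (auto intro: image_eqI[of _ _ "-l"])
  then have "l = 0" using proper unfolding proper_cone_def by blast
  then show False using \<open>norm l = 1\<close> by simp
qed

lemma compact_interval: "compact {z. z - a \<in> closure C \<and> b - z \<in> closure C}" (is "compact ?I")
proof -
  obtain R where R: "\<And>z. z \<in> closure C \<Longrightarrow> b - a - z \<in> closure C \<Longrightarrow> norm z \<le> R"
    using bounded_interval_zero[of "b - a"] by (auto simp: bounded_iff)
  have "?I \<subseteq> cball 0 (R + norm a)"
  proof
    fix z assume "z \<in> ?I"
    then have "norm (z - a) \<le> R" by (intro R) auto
    then show "z \<in> cball 0 (R + norm a)" using norm_triangle_sub[of z a] by simp
  qed
  moreover have "closed ?I"
  proof -
    have "?I = (\<lambda>z. z - a) -` closure C \<inter> (\<lambda>z. b - z) -` closure C" by auto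
    then show ?thesis by (auto intro!: closed_Int continuous_closed_vimage continuous_intros)
  qed
  ultimately show ?thesis using compact_cball compact_Int_closed by (metis Int_absorb1)
qed

text \<open>Both inequalities use the closed cone, so the set is compact in the whole space; the
  strictly positive lower bound is what places it inside \<open>C\<close>. \<open>Suc\<close> avoids
  a division by zero at the first index.\<close>

definition exhaustion :: "nat \<Rightarrow> 'a set" where
  "exhaustion n = {z. z - (1 / Suc n) *\<^sub>R e \<in> closure C \<and> real (Suc n) *\<^sub>R e - z \<in> closure C}"

lemma scaleR_inverse_Suc_LIMSEQ: "(\<lambda>n. (1 / real (Suc n)) *\<^sub>R x) \<longlonglongrightarrow> (0::'b::real_normed_vector)"
  using tendsto_scaleR[OF LIMSEQ_inverse_real_of_nat tendsto_const[of x]] by (simp add: inverse_eq_divide)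

lemma eventually_shift:
  assumes "open U" "x \<in> U"
  shows "\<forall>\<^sub>F n in sequentially. x - (1 / real (Suc n)) *\<^sub>R e \<in> U"
proof -
  have "(\<lambda>n. x - (1 / real (Suc n)) *\<^sub>R e) \<longlonglongrightarrow> x - 0"
    by (intro tendsto_diff tendsto_const scaleR_inverse_Suc_LIMSEQ)
  then show ?thesis using topological_tendstoD[of _ x sequentially U] assms by simp
qed

text \<open>An interior point of a cone is an order unit: \<open>e - x / Suc n\<close> tends to
  \<open>e\<close>, hence enters the open set \<open>C\<close>, and can be rescaled.\<close>

lemma eventually_dominated: "\<forall>\<^sub>F n in sequentially. real (Suc n) *\<^sub>R e - x \<in> C"
proof -
  have "(\<lambda>n. e - (1 / real (Suc n)) *\<^sub>R x) \<longlonglongrightarrow> e - 0"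
    by (intro tendsto_diff tendsto_const scaleR_inverse_Suc_LIMSEQ)
  then have "\<forall>\<^sub>F n in sequentially. e - (1 / real (Suc n)) *\<^sub>R x \<in> C"
    using topological_tendstoD[of _ e sequentially C] open_C e_in_C by simp
  then show ?thesis
  proof eventually_elim
    case (elim n)
    then have "real (Suc n) *\<^sub>R (e - (1 / real (Suc n)) *\<^sub>R x) \<in> C" by (rule scale_C) simp
    then show ?case by (simp add: scaleR_right_diff_distrib del: of_nat_Suc)
  qed
qed

lemma scale_e_mono:
  assumes "s \<le> t" "x - t *\<^sub>R e \<in> C"
  shows "x - s *\<^sub>R e \<in> C"
proof (cases "s = t")
  case False
  then have "(x - t *\<^sub>R e) + (t - s) *\<^sub>R e \<in> C" using assms by (intro add_C scale_C e_in_C) auto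
  then show ?thesis by (simp add: algebra_simps)
qed (use assms in simp)

lemma scale_e_mono_closure:
  assumes "s \<le> t" "x - t *\<^sub>R e \<in> closure C"
  shows "x - s *\<^sub>R e \<in> closure C"
proof (cases "s = t")
  case False
  then have "(x - t *\<^sub>R e) + (t - s) *\<^sub>R e \<in> closure C"
    using assms by (intro closure_add C_subset_closure[OF scale_C] e_in_C) auto
  then show ?thesis by (simp add: algebra_simps)
qed (use assms in simp)

lemma compact_exhaustion: "compact (exhaustion n)"
  unfolding exhaustion_def by (rule compact_interval)

lemma incseq_exhaustion: "incseq exhaustion"
proof (rule incseq_SucI, rule subsetI)
  fix n x assume "x \<in> exhaustion n"
  then have x: "x - (1 / real (Suc n)) *\<^sub>R e \<in> closure C" "- x - (- real (Suc n)) *\<^sub>R e \<in> closure C"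
    by (simp_all add: exhaustion_def del: of_nat_Suc)
  have "1 / real (Suc (Suc n)) \<le> 1 / real (Suc n)" by (simp add: frac_le)
  then have "x - (1 / real (Suc (Suc n))) *\<^sub>R e \<in> closure C" using x(1) by (rule scale_e_mono_closure)
  moreover have "- x - (- real (Suc (Suc n))) *\<^sub>R e \<in> closure C"
    by (rule scale_e_mono_closure[OF _ x(2)]) simp
  ultimately show "x \<in> exhaustion (Suc n)" by (simp add: exhaustion_def del: of_nat_Suc)
qed

lemma Union_exhaustion: "(\<Union>n. exhaustion n) = C"
proof (intro equalityI subsetI)
  fix x assume "x \<in> (\<Union>n. exhaustion n)"
  then obtain n where n: "x - (1 / real (Suc n)) *\<^sub>R e \<in> closure C" by (auto simp: exhaustion_def)
  have "(1 / real (Suc n)) *\<^sub>R e + (x - (1 / real (Suc n)) *\<^sub>R e) \<in> C"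
    by (intro add_C_closure scale_C e_in_C n) simp
  then show "x \<in> C" by simp
next
  fix x assume x: "x \<in> C"
  have "\<forall>\<^sub>F n in sequentially. x \<in> exhaustion n"
    using eventually_shift[OF open_C x] eventually_dominated[of x]
    by eventually_elim (simp add: exhaustion_def C_subset_closure del: of_nat_Suc)
  then show "x \<in> (\<Union>n. exhaustion n)" using eventually_happens'[OF sequentially_bot] by blast
qed

section \<open>Open upper sets\<close>

definition open_upper :: "'a set \<Rightarrow> bool" where
  "open_upper U \<longleftrightarrow> openin (top_of_set C) U \<and> upper_set C U"

lemma open_upper_iff:
  "open_upper U \<longleftrightarrow> open U \<and> U \<subseteq> C \<and> (\<forall>x\<in>U. \<forall>y\<in>C. y - x \<in> closure C \<longrightarrow> y \<in> U)"
  unfolding open_upper_def upper_set_def cone_le_def using open_C openin_open_eq by blast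

lemma stoch_le_iff: "stoch_le C M N \<longleftrightarrow> (\<forall>U. open_upper U \<longrightarrow> measure M U \<le> measure N U)"
  unfolding stoch_le_def open_upper_def by blast

lemma open_upper_sets: "M \<in> prob_measures_on C \<Longrightarrow> open_upper U \<Longrightarrow> U \<in> sets M"
  using open_C by (auto simp: prob_measures_onD(2) open_upper_iff sets_restrict_space_iff)

text \<open>Serves two purposes: \<open>a = t *\<^sub>R e\<close> yields the inner shifts of
  \<open>U\<close>, and \<open>U = C\<close> yields the points strictly above \<open>a\<close>, the
  lower faces of order boxes.\<close>

lemma open_upper_above:
  assumes "open_upper U"
  shows "open_upper {x \<in> C. x - a \<in> U}"
  unfolding open_upper_iff
proof (intro conjI ballI impI)
  have "{x \<in> C. x - a \<in> U} = C \<inter> (\<lambda>x. x - a) -` U" by auto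
  then show "open {x \<in> C. x - a \<in> U}"
    using assms open_C by (auto simp: open_upper_iff intro!: open_Int continuous_open_vimage continuous_intros)
  fix x y assume x: "x \<in> {x \<in> C. x - a \<in> U}" and y: "y \<in> C" "y - x \<in> closure C"
  have "(x - a) + (y - x) \<in> C" using x y assms by (intro add_C_closure) (auto simp: open_upper_iff)
  then have "y - a \<in> C" by simp
  moreover have "(y - a) - (x - a) \<in> closure C" using y by simp
  ultimately have "y - a \<in> U" using x assms unfolding open_upper_iff by blast
  then show "y \<in> {x \<in> C. x - a \<in> U}" using y by simp
qed auto

lemma open_upper_C: "open_upper C"
  using open_C by (simp add: open_upper_iff)

lemma open_upper_not_below: "open_upper {x \<in> C. b - x \<notin> closure C}"
  unfolding open_upper_iff
proof (intro conjI ballI impI)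
  have "{x \<in> C. b - x \<notin> closure C} = C \<inter> (\<lambda>x. b - x) -` (- closure C)" by auto
  then show "open {x \<in> C. b - x \<notin> closure C}"
    using open_C by (auto intro!: open_Int continuous_open_vimage continuous_intros)
  fix x y assume x: "x \<in> {x \<in> C. b - x \<notin> closure C}" and y: "y \<in> C" "y - x \<in> closure C"
  have "b - y \<notin> closure C"
  proof
    assume "b - y \<in> closure C"
    then have "(b - y) + (y - x) \<in> closure C" using y by (intro closure_add)
    then show False using x by simp
  qed
  then show "y \<in> {x \<in> C. b - x \<notin> closure C}" using y by simp
qed auto

lemma open_upper_Int: "open_upper U \<Longrightarrow> open_upper V \<Longrightarrow> open_upper (U \<inter> V)"
  by (auto simp: open_upper_iff)

section \<open>Order intervals of measures\<close>

lemma tight_order_interval: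
  assumes \<alpha>: "\<alpha> \<in> prob_measures_on C" and \<beta>: "\<beta> \<in> prob_measures_on C"
    and M: "\<And>n. M n \<in> prob_measures_on C"
    and le: "\<And>n. stoch_le C \<alpha> (M n)" "\<And>n. stoch_le C (M n) \<beta>" and "\<epsilon> > 0"
  shows "\<exists>k. \<forall>n. measure (M n) (exhaustion k) > 1 - \<epsilon>"
proof -
  interpret \<alpha>: prob_space \<alpha> using \<alpha> by (rule prob_measures_onD)
  interpret \<beta>: prob_space \<beta> using \<beta> by (rule prob_measures_onD)
  interpret M: prob_space "M n" for n using M by (rule prob_measures_onD)
  \<comment> \<open>\<open>A k\<close> asks for membership in \<open>C\<close> instead of its
    closure so that it is open and can be tested by the stochastic order. A point of
    \<open>A k\<close> outside \<open>exhaustion k\<close> can only fail the upper bound, hence lies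
    in \<open>B k\<close>.\<close>
  define A where "A k = {x \<in> C. x - (1 / real (Suc k)) *\<^sub>R e \<in> C}" for k
  define B where "B k = {x \<in> C. real (Suc k) *\<^sub>R e - x \<notin> closure C}" for k
  have A: "open_upper (A k)" for k unfolding A_def by (rule open_upper_above[OF open_upper_C])
  have B: "open_upper (B k)" for k unfolding B_def by (rule open_upper_not_below)
  have "incseq A"
  proof (rule incseq_SucI, rule subsetI)
    fix k x assume x: "x \<in> A k"
    have "1 / real (Suc (Suc k)) \<le> 1 / real (Suc k)" by (simp add: frac_le)
    then show "x \<in> A (Suc k)" using x scale_e_mono by (auto simp: A_def simp del: of_nat_Suc)
  qed
  moreover have "(\<Union>k. A k) = space \<alpha>"
  proof -
    have "\<exists>k. x \<in> A k" if "x \<in> C" for x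
      using eventually_happens'[OF sequentially_bot eventually_shift[OF open_C that]] that
      by (auto simp: A_def simp del: of_nat_Suc)
    then show ?thesis by (auto simp: A_def prob_measures_onD(3)[OF \<alpha>])
  qed
  ultimately have "(\<lambda>k. measure \<alpha> (A k)) \<longlonglongrightarrow> 1"
    using \<alpha>.finite_Lim_measure_incseq[of A] open_upper_sets[OF \<alpha> A] \<alpha>.prob_space by auto
  moreover have "(\<lambda>k. measure \<beta> (B k)) \<longlonglongrightarrow> 0"
  proof -
    have "decseq B"
    proof (rule decseq_SucI, rule subsetI)
      fix k x assume x: "x \<in> B (Suc k)"
      have "real (Suc (Suc k)) *\<^sub>R e - x \<in> closure C" if "real (Suc k) *\<^sub>R e - x \<in> closure C"
        using that scale_e_mono_closure[of "- real (Suc (Suc k))" "- real (Suc k)" "- x"]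
        by (simp del: of_nat_Suc)
      then show "x \<in> B k" using x by (auto simp: B_def simp del: of_nat_Suc)
    qed
    moreover have "(\<Inter>k. B k) = {}"
    proof -
      have "\<exists>k. x \<notin> B k" for x
        using eventually_happens'[OF sequentially_bot eventually_dominated[of x]] C_subset_closure
        by (auto simp: B_def simp del: of_nat_Suc)
      then show ?thesis by auto
    qed
    ultimately show ?thesis
      using \<beta>.finite_Lim_measure_decseq[of B] open_upper_sets[OF \<beta> B] by auto
  qed
  ultimately have "(\<lambda>k. measure \<alpha> (A k) - measure \<beta> (B k)) \<longlonglongrightarrow> 1 - 0" by (rule tendsto_diff)
  then have "\<forall>\<^sub>F k in sequentially. measure \<alpha> (A k) - measure \<beta> (B k) > 1 - \<epsilon>"
    using order_tendstoD(1)[of _ "1 - 0" sequentially "1 - \<epsilon>"] \<open>\<epsilon> > 0\<close> by simp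
  \<comment> \<open>This \<open>k\<close> depends on \<open>\<alpha>\<close> and
    \<open>\<beta>\<close> alone, which gives uniformity in \<open>n\<close>.\<close>
  then obtain k where k: "measure \<alpha> (A k) - measure \<beta> (B k) > 1 - \<epsilon>"
    using eventually_happens'[OF sequentially_bot] by blast
  have "measure (M n) (exhaustion k) > 1 - \<epsilon>" for n
  proof -
    have ex: "exhaustion k \<in> sets (M n)"
      using Union_exhaustion open_C compact_exhaustion[of k]
      by (auto simp: prob_measures_onD(2)[OF M] sets_restrict_space_iff intro: borel_closed compact_imp_closed)
    have "A k \<subseteq> exhaustion k \<union> B k"
      by (auto simp: A_def B_def exhaustion_def C_subset_closure)
    then have "measure (M n) (A k) \<le> measure (M n) (exhaustion k \<union> B k)"
      using ex open_upper_sets[OF M B] by (intro M.finite_measure_mono) auto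
    also have "\<dots> \<le> measure (M n) (exhaustion k) + measure (M n) (B k)"
      using ex open_upper_sets[OF M B] by (intro measure_Un_le) auto
    finally have "measure (M n) (A k) - measure (M n) (B k) \<le> measure (M n) (exhaustion k)" by simp
    moreover have "measure \<alpha> (A k) \<le> measure (M n) (A k)" "measure (M n) (B k) \<le> measure \<beta> (B k)"
      using le A B by (auto simp: stoch_le_iff)
    ultimately show ?thesis using k by linarith
  qed
  then show ?thesis by blast
qed

lemma order_interval_sequentially_compact:
  assumes "\<alpha> \<in> prob_measures_on C" "\<beta> \<in> prob_measures_on C" "\<And>n::nat. M n \<in> prob_measures_on C"
    and "\<And>n. stoch_le C \<alpha> (M n)" "\<And>n. stoch_le C (M n) \<beta>"
  shows "\<exists>r \<mu>. strict_mono r \<and> \<mu> \<in> prob_measures_on C \<and> weakly_converges C (M \<circ> r) \<mu>"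
proof (rule Prokhorov_sigma_compact)
  show "\<exists>k. \<forall>n. measure (M n) (exhaustion k) > 1 - \<epsilon>" if "\<epsilon> > 0" for \<epsilon>
    using assms that by (rule tight_order_interval)
qed (simp_all add: compact_exhaustion incseq_exhaustion Union_exhaustion assms)

section \<open>Closedness of the stochastic order under weak limits\<close>

text \<open>
  The set \<open>U + t e\<close> has its closure relative to \<open>C\<close> contained in \<open>U\<close>. This is what makes both
  halves of the portmanteau theorem applicable to one and the same open upper set.
\<close>

lemma Urysohn_open_upper:
  assumes U: "open_upper U" and "t > 0"
  shows "\<exists>f :: 'a \<Rightarrow> real. continuous_on C f \<and> (\<forall>x\<in>C. 0 \<le> f x \<and> f x \<le> 1) \<and>
    (\<forall>x\<in>C. x - t *\<^sub>R e \<in> U \<longrightarrow> f x = 1) \<and> (\<forall>x\<in>C. x \<notin> U \<longrightarrow> f x = 0)"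
proof -
  define V where "V = {x \<in> C. x - t *\<^sub>R e \<in> U}"
  define S where "S = C \<inter> closure V"
  have "S \<subseteq> U"
  proof
    fix x assume "x \<in> S"
    then have x: "x \<in> C" "x \<in> closure V" by (auto simp: S_def)
    obtain d where d: "d > 0" "ball (t *\<^sub>R e) d \<subseteq> C"
      using open_C scale_C[OF e_in_C \<open>t > 0\<close>] open_contains_ball by blast
    obtain v where v: "v \<in> V" "dist v x < d" using x(2) d(1) by (auto simp: closure_approachable)
    \<comment> \<open>The shift pays for the approximation: \<open>t *\<^sub>R e\<close> stays in
      \<open>C\<close> after the small perturbation \<open>x - v\<close>, so \<open>x\<close> lies
      above the point \<open>v - t *\<^sub>R e\<close> of \<open>U\<close>.\<close>
    have "t *\<^sub>R e + (x - v) \<in> ball (t *\<^sub>R e) d" using v(2) by (simp add: dist_norm norm_minus_commute)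
    then have "t *\<^sub>R e + (x - v) \<in> closure C" using d(2) C_subset_closure by blast
    moreover have "t *\<^sub>R e + (x - v) = x - (v - t *\<^sub>R e)" by simp
    moreover have "v - t *\<^sub>R e \<in> U" using v(1) by (simp add: V_def)
    ultimately show "x \<in> U" using U x(1) unfolding open_upper_iff by metis
  qed
  then have disj: "disjnt (C - U) S" by (auto simp: disjnt_def)
  have nrm: "normal_space (top_of_set C)"
    by (intro metrizable_imp_normal_space metrizable_space_subtopology metrizable_space_euclidean)
  have "closedin (top_of_set C) (C - U)"
    using U by (intro closedin_diff) (auto simp: open_upper_def)
  moreover have "closedin (top_of_set C) S" unfolding S_def by (intro closedin_closed_Int) simp
  ultimately obtain f where f: "continuous_map (top_of_set C) (top_of_set {0..1::real}) f"
    "f ` (C - U) \<subseteq> {0}" "f ` S \<subseteq> {1}"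
    using Urysohn_lemma[OF nrm _ _ disj, of 0 1] by auto
  show ?thesis
  proof (intro exI[of _ f] conjI ballI impI)
    show "continuous_on C f" using f(1) by (auto simp: continuous_map_in_subtopology)
    show "0 \<le> f x" "f x \<le> 1" if "x \<in> C" for x
      using f(1) that by (auto simp: continuous_map_in_subtopology)
    show "f x = 1" if "x \<in> C" "x - t *\<^sub>R e \<in> U" for x
    proof -
      have "x \<in> V" using that by (simp add: V_def)
      then have "x \<in> S" using that(1) closure_subset[of V] by (auto simp: S_def)
      then show ?thesis using f(3) by auto
    qed
    show "f x = 0" if "x \<in> C" "x \<notin> U" for x using f(2) that by auto
  qed
qed

text \<open>Since \<open>U\<close> is open and upper, its shifts increase to \<open>U\<close> as
  \<open>t\<close> decreases to 0, and continuity from below applies. An estimate that loses a shift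
  therefore loses nothing in the end.\<close>

lemma measure_le_of_inner_shifts:
  assumes N: "N \<in> prob_measures_on C" and U: "open_upper U"
    and le: "\<And>t. t > 0 \<Longrightarrow> measure N {x \<in> C. x - t *\<^sub>R e \<in> U} \<le> b"
  shows "measure N U \<le> b"
proof -
  interpret N: prob_space N using N by (rule prob_measures_onD)
  define V where "V n = {x \<in> C. x - (1 / real (Suc n)) *\<^sub>R e \<in> U}" for n
  have V: "open_upper (V n)" for n unfolding V_def by (rule open_upper_above[OF U])
  have mono: "x - s *\<^sub>R e \<in> U" if "s \<le> t" "x - t *\<^sub>R e \<in> U" for x s t
  proof -
    have "(x - s *\<^sub>R e) - (x - t *\<^sub>R e) \<in> closure C" if "s < t"
    proof -
      have "(t - s) *\<^sub>R e \<in> C" using that by (intro scale_C e_in_C) simp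
      then show ?thesis by (intro C_subset_closure) (simp add: algebra_simps)
    qed
    moreover have "x - s *\<^sub>R e \<in> C"
      using scale_e_mono[OF that(1)] that(2) U by (auto simp: open_upper_iff)
    ultimately show ?thesis using U that unfolding open_upper_iff by (metis less_eq_real_def)
  qed
  have "incseq V"
  proof (rule incseq_SucI, rule subsetI)
    fix k x assume x: "x \<in> V k"
    have "1 / real (Suc (Suc k)) \<le> 1 / real (Suc k)" by (simp add: frac_le)
    then show "x \<in> V (Suc k)" using x mono by (auto simp: V_def simp del: of_nat_Suc)
  qed
  moreover have "(\<Union>n. V n) = U"
  proof
    have "x \<in> U" if "x \<in> V n" for x n
      using mono[of 0 "1 / real (Suc n)" x] that by (simp add: V_def del: of_nat_Suc)
    then show "(\<Union>n. V n) \<subseteq> U" by blast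
    have "\<exists>n. x \<in> V n" if "x \<in> U" for x
      using eventually_happens'[OF sequentially_bot eventually_shift[of U x]] that U
      by (auto simp: V_def open_upper_iff simp del: of_nat_Suc)
    then show "U \<subseteq> (\<Union>n. V n)" by blast
  qed
  ultimately have "(\<lambda>n. measure N (V n)) \<longlonglongrightarrow> measure N U"
    using N.finite_Lim_measure_incseq[of V] open_upper_sets[OF N V] by auto
  moreover have "measure N (V n) \<le> b" for n unfolding V_def by (rule le) simp
  ultimately show ?thesis by (intro LIMSEQ_le_const2) auto
qed

lemma measure_le_integral:
  fixes f :: "'a \<Rightarrow> real"
  assumes M: "M \<in> prob_measures_on C" and f: "continuous_on C f" "\<And>x. x \<in> C \<Longrightarrow> 0 \<le> f x \<and> f x \<le> 1"
    and A: "A \<in> sets M" "\<And>x. x \<in> A \<Longrightarrow> f x = 1"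
  shows "measure M A \<le> integral\<^sup>L M f"
proof -
  interpret prob_space M using M by (rule prob_measures_onD)
  have "integrable M f" using f by (intro integrable_bounded_continuous[OF M f(1), of 1]) auto
  then have "integral\<^sup>L M (indicator A) \<le> integral\<^sup>L M f"
    using f A prob_measures_onD(3)[OF M]
    by (intro integral_mono) (auto simp: emeasure_eq_measure split: split_indicator)
  then show ?thesis using sets.sets_into_space[OF A(1)] by (simp add: Int_absorb2)
qed

lemma integral_le_measure:
  fixes f :: "'a \<Rightarrow> real"
  assumes M: "M \<in> prob_measures_on C" and f: "continuous_on C f" "\<And>x. x \<in> C \<Longrightarrow> 0 \<le> f x \<and> f x \<le> 1"
    and A: "A \<in> sets M" "\<And>x. x \<in> C \<Longrightarrow> x \<notin> A \<Longrightarrow> f x = 0"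
  shows "integral\<^sup>L M f \<le> measure M A"
proof -
  interpret prob_space M using M by (rule prob_measures_onD)
  have "integrable M f" using f by (intro integrable_bounded_continuous[OF M f(1), of 1]) auto
  then have "integral\<^sup>L M f \<le> integral\<^sup>L M (indicator A)"
    using f A prob_measures_onD(3)[OF M]
    by (intro integral_mono) (auto simp: emeasure_eq_measure split: split_indicator)
  then show ?thesis using sets.sets_into_space[OF A(1)] by (simp add: Int_absorb2)
qed

lemma weakly_convergesD:
  assumes "weakly_converges C M \<mu>" "continuous_on C f" "\<And>x. x \<in> C \<Longrightarrow> 0 \<le> f x \<and> f x \<le> (1::real)"
  shows "(\<lambda>n. integral\<^sup>L (M n) f) \<longlonglongrightarrow> integral\<^sup>L \<mu> f"
proof -
  have "bounded (f ` C)" using assms(3) by (auto simp: bounded_iff intro!: exI[of _ 1])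
  then show ?thesis using assms unfolding weakly_converges_def by blast
qed

text \<open>With \<open>V\<close> the shift of \<open>U\<close>, the chain is
  \<open>N V \<le> M n V \<le> \<integral> f dM n\<close>, whose limit is at most
  \<open>\<mu> U\<close>. The order is assumed only eventually, because a term of a monotone
  sequence is comparable in the required direction only with later terms.\<close>

lemma stoch_le_weak_limit:
  assumes N: "N \<in> prob_measures_on C" and M: "\<And>n. M n \<in> prob_measures_on C"
    and \<mu>: "\<mu> \<in> prob_measures_on C" and w: "weakly_converges C M \<mu>"
    and le: "\<forall>\<^sub>F n in sequentially. stoch_le C N (M n)"
  shows "stoch_le C N \<mu>"
  unfolding stoch_le_iff
proof (intro allI impI, rule measure_le_of_inner_shifts[OF N], assumption)
  fix U t assume U: "open_upper U" and "t > (0::real)"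
  obtain f :: "'a \<Rightarrow> real" where f: "continuous_on C f" "\<And>x. x \<in> C \<Longrightarrow> 0 \<le> f x \<and> f x \<le> 1"
    and f1: "\<And>x. x \<in> C \<Longrightarrow> x - t *\<^sub>R e \<in> U \<Longrightarrow> f x = 1" and f0: "\<And>x. x \<in> C \<Longrightarrow> x \<notin> U \<Longrightarrow> f x = 0"
    using Urysohn_open_upper[OF U \<open>t > 0\<close>] by auto
  have V: "open_upper {x \<in> C. x - t *\<^sub>R e \<in> U}" by (rule open_upper_above[OF U])
  have lim: "(\<lambda>n. integral\<^sup>L (M n) f) \<longlonglongrightarrow> integral\<^sup>L \<mu> f"
    using w f by (rule weakly_convergesD)
  have "\<forall>\<^sub>F n in sequentially. measure N {x \<in> C. x - t *\<^sub>R e \<in> U} \<le> integral\<^sup>L (M n) f"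
    using le
  proof eventually_elim
    case (elim n)
    then have "measure N {x \<in> C. x - t *\<^sub>R e \<in> U} \<le> measure (M n) {x \<in> C. x - t *\<^sub>R e \<in> U}"
      using V by (simp add: stoch_le_iff)
    also have "\<dots> \<le> integral\<^sup>L (M n) f"
      using f1 by (intro measure_le_integral[OF M f] open_upper_sets[OF M V]) auto
    finally show ?case .
  qed
  then have "measure N {x \<in> C. x - t *\<^sub>R e \<in> U} \<le> integral\<^sup>L \<mu> f"
    by (rule tendsto_lowerbound[OF lim _ sequentially_bot])
  also have "\<dots> \<le> measure \<mu> U"
    using f0 by (intro integral_le_measure[OF \<mu> f] open_upper_sets[OF \<mu> U]) auto
  finally show "measure N {x \<in> C. x - t *\<^sub>R e \<in> U} \<le> measure \<mu> U" .
qed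

text \<open>The same function is read the other way: it dominates the shift under
  \<open>\<mu>\<close> and is dominated by \<open>U\<close> under each \<open>M n\<close>.\<close>

lemma weak_limit_stoch_le:
  assumes N: "N \<in> prob_measures_on C" and M: "\<And>n. M n \<in> prob_measures_on C"
    and \<mu>: "\<mu> \<in> prob_measures_on C" and w: "weakly_converges C M \<mu>"
    and le: "\<forall>\<^sub>F n in sequentially. stoch_le C (M n) N"
  shows "stoch_le C \<mu> N"
  unfolding stoch_le_iff
proof (intro allI impI, rule measure_le_of_inner_shifts[OF \<mu>], assumption)
  fix U t assume U: "open_upper U" and "t > (0::real)"
  obtain f :: "'a \<Rightarrow> real" where f: "continuous_on C f" "\<And>x. x \<in> C \<Longrightarrow> 0 \<le> f x \<and> f x \<le> 1"
    and f1: "\<And>x. x \<in> C \<Longrightarrow> x - t *\<^sub>R e \<in> U \<Longrightarrow> f x = 1" and f0: "\<And>x. x \<in> C \<Longrightarrow> x \<notin> U \<Longrightarrow> f x = 0"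
    using Urysohn_open_upper[OF U \<open>t > 0\<close>] by auto
  have V: "open_upper {x \<in> C. x - t *\<^sub>R e \<in> U}" by (rule open_upper_above[OF U])
  have "measure \<mu> {x \<in> C. x - t *\<^sub>R e \<in> U} \<le> integral\<^sup>L \<mu> f"
    using f1 by (intro measure_le_integral[OF \<mu> f] open_upper_sets[OF \<mu> V]) auto
  also have "integral\<^sup>L \<mu> f \<le> measure N U"
  proof (rule tendsto_upperbound[OF _ _ sequentially_bot])
    show "(\<lambda>n. integral\<^sup>L (M n) f) \<longlonglongrightarrow> integral\<^sup>L \<mu> f"
      using w f by (rule weakly_convergesD)
    show "\<forall>\<^sub>F n in sequentially. integral\<^sup>L (M n) f \<le> measure N U"
      using le
    proof eventually_elim
      case (elim n)
      have "integral\<^sup>L (M n) f \<le> measure (M n) U"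
        using f0 by (intro integral_le_measure[OF M f] open_upper_sets[OF M U]) auto
      also have "\<dots> \<le> measure N U" using elim U by (simp add: stoch_le_iff)
      finally show ?case .
    qed
  qed
  finally show "measure \<mu> {x \<in> C. x - t *\<^sub>R e \<in> U} \<le> measure N U" .
qed

section \<open>Open upper sets generate the Borel sets\<close>

text \<open>Scaling by \<open>Suc n\<close> and translating by \<open>e\<close> turns the condition
  on \<open>y - z\<close> into membership in the fixed interval from 0 to
  \<open>2 *\<^sub>R e\<close>, which is bounded. Hence the distance is at most
  \<open>(R + norm e) / Suc n\<close>.\<close>

lemma small_order_interval:
  assumes "r > 0"
  obtains n where "\<And>y z. y - z + (1 / real (Suc n)) *\<^sub>R e \<in> closure C \<Longrightarrow>
    z + (1 / real (Suc n)) *\<^sub>R e - y \<in> closure C \<Longrightarrow> dist z y < r"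
proof -
  obtain R where R: "\<And>z. z \<in> closure C \<Longrightarrow> 2 *\<^sub>R e - z \<in> closure C \<Longrightarrow> norm z \<le> R"
    using bounded_interval_zero[of "2 *\<^sub>R e"] by (auto simp: bounded_iff)
  obtain n :: nat where n: "(R + norm e) / r < real n" using reals_Archimedean2 by blast
  then have n': "R + norm e < r * real (Suc n)" using assms by (simp add: field_simps)
  have "dist z y < r" if y: "y - z + (1 / real (Suc n)) *\<^sub>R e \<in> closure C"
    "z + (1 / real (Suc n)) *\<^sub>R e - y \<in> closure C" for y z
  proof -
    define m where "m = real (Suc n)"
    have m: "m > 0" by (simp add: m_def)
    have "m *\<^sub>R (y - z + (1 / m) *\<^sub>R e) \<in> closure C" "m *\<^sub>R (z + (1 / m) *\<^sub>R e - y) \<in> closure C"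
      using y m unfolding m_def by (auto intro!: closure_scale simp del: of_nat_Suc)
    moreover have "m *\<^sub>R (y - z + (1 / m) *\<^sub>R e) = m *\<^sub>R (y - z) + e"
      "m *\<^sub>R (z + (1 / m) *\<^sub>R e - y) = 2 *\<^sub>R e - (m *\<^sub>R (y - z) + e)"
      using m by (simp_all add: algebra_simps scaleR_2)
    ultimately have "norm (m *\<^sub>R (y - z) + e) \<le> R" by (intro R) auto
    then have "norm (m *\<^sub>R (y - z)) \<le> R + norm e"
      using norm_triangle_ineq4[of "m *\<^sub>R (y - z) + e" e] by simp
    then have "m * norm (y - z) \<le> R + norm e" using m by simp
    also have "\<dots> < m * r" using n' by (simp only: m_def mult.commute)
    finally show ?thesis using m by (simp add: dist_norm norm_minus_commute)
  qed
  then show thesis by (rule that)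
qed

text \<open>Order boxes are differences of two open upper sets. They are small in norm and contain
  neighbourhoods of their centres in \<open>C\<close>, so countably many centres and sizes suffice
  to build every open subset of \<open>C\<close>.\<close>

lemma sigma_sets_open_upper: "sigma_sets C (Collect open_upper) = sets (restrict_space borel C)"
proof
  show "sigma_sets C (Collect open_upper) \<subseteq> sets (restrict_space borel C)"
  proof -
    have "sigma_sets (space (restrict_space borel C)) (Collect open_upper) \<subseteq> sets (restrict_space borel C)"
      using open_C by (intro sets.sigma_sets_subset) (auto simp: open_upper_iff sets_restrict_space_iff)
    then show ?thesis by (simp add: space_restrict_space)
  qed
  interpret sa: sigma_algebra C "sigma_sets C (Collect open_upper)"
    by (rule sigma_algebra_sigma_sets) (auto simp: open_upper_iff)
  obtain F :: "nat \<Rightarrow> nat \<Rightarrow> 'a set" where F: "\<And>k m. finite (F k m)"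
    "\<And>k m. exhaustion k \<subseteq> (\<Union>z\<in>F k m. ball z (1 / Suc m))"
    using sigma_compact_nets[of exhaustion] compact_exhaustion by blast
  define D where "D = (\<Union>k m. F k m)"
  have "countable D" unfolding D_def
    by (intro countable_UN[OF countableI_type] countable_finite F)
  have dense: "\<exists>z\<in>D. dist z x < r" if x: "x \<in> C" and "r > 0" for x r
  proof -
    obtain k where "x \<in> exhaustion k" using x Union_exhaustion by blast
    obtain m where m: "1 / real (Suc m) < r" using nat_approx_posE[OF \<open>r > 0\<close>] by metis
    obtain z where "z \<in> F k m" "x \<in> ball z (1 / Suc m)" using F(2) \<open>x \<in> exhaustion k\<close> by blast
    then show ?thesis using m by (intro bexI[of _ z]) (auto simp: D_def)
  qed
  define B where "B z n = {x \<in> C. x - (z - (1 / real (Suc n)) *\<^sub>R e) \<in> C} -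
      {x \<in> C. (z + (1 / real (Suc n)) *\<^sub>R e) - x \<notin> closure C}" for z n
  have B: "B z n \<in> sigma_sets C (Collect open_upper)" for z n
    unfolding B_def using open_upper_above[OF open_upper_C] open_upper_not_below
    by (intro sa.Diff sigma_sets.Basic) auto
  have open_sigma: "W \<in> sigma_sets C (Collect open_upper)" if W: "open W" "W \<subseteq> C" for W
  proof -
    define I where "I = {(z, n) \<in> D \<times> UNIV. B z n \<subseteq> W}"
    have "countable I"
      by (rule countable_subset[of _ "D \<times> UNIV"]) (use \<open>countable D\<close> in \<open>auto simp: I_def\<close>)
    have "W = (\<Union>(z, n)\<in>I. B z n)"
    proof
      show "(\<Union>(z, n)\<in>I. B z n) \<subseteq> W" by (auto simp: I_def)
      show "W \<subseteq> (\<Union>(z, n)\<in>I. B z n)"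
      proof
        fix x assume x: "x \<in> W"
        then obtain r where r: "r > 0" "ball x r \<subseteq> W" using W(1) open_contains_ball by blast
        \<comment> \<open>The size of the box is fixed before its centre: half of \<open>r\<close>
          is spent on the box and half on the distance from \<open>z\<close> to
          \<open>x\<close>.\<close>
        obtain n where n: "\<And>y z. y - z + (1 / real (Suc n)) *\<^sub>R e \<in> closure C \<Longrightarrow>
            z + (1 / real (Suc n)) *\<^sub>R e - y \<in> closure C \<Longrightarrow> dist z y < r / 2"
          using small_order_interval[of "r / 2"] r(1) by (metis half_gt_zero)
        define a where "a = (1 / real (Suc n)) *\<^sub>R e"
        have "a \<in> C" unfolding a_def by (intro scale_C e_in_C) simp
        \<comment> \<open>The ball around \<open>a\<close> gives the tolerance for the centre: if
          \<open>z\<close> is within \<open>d\<close> of \<open>x\<close>, then \<open>x\<close>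
          still lies between \<open>z - a\<close> and \<open>z + a\<close>.\<close>
        then obtain d where d: "d > 0" "ball a d \<subseteq> C" using open_C open_contains_ball by blast
        obtain z where z: "z \<in> D" "dist z x < min d (r / 2)"
          using dense[of x "min d (r / 2)"] x W(2) d(1) r(1) by auto
        have "a + (x - z) \<in> ball a d" "a + (z - x) \<in> ball a d"
          using z(2) by (auto simp: dist_norm norm_minus_commute)
        then have az: "a + (x - z) \<in> C" "a + (z - x) \<in> C" using d(2) by auto
        moreover have "a + (x - z) = x - (z - a)" "a + (z - x) = z + a - x" by auto
        ultimately have "x \<in> B z n" using x W(2) C_subset_closure by (auto simp: B_def a_def[symmetric] simp del: of_nat_Suc)
        moreover have "B z n \<subseteq> W"
        proof
          fix y assume y: "y \<in> B z n"
          then have "y - (z - a) \<in> C" "z + a - y \<in> closure C" unfolding B_def a_def by blast+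
          moreover have "y - (z - a) = y - z + a" by simp
          ultimately have "y - z + a \<in> closure C" "z + a - y \<in> closure C" using C_subset_closure by auto
          then have "dist z y < r / 2" using n unfolding a_def by blast
          then have "dist x y < r" using z(2) dist_triangle[of x y z] by (simp add: dist_commute)
          then show "y \<in> W" using r(2) by auto
        qed
        ultimately show "x \<in> (\<Union>(z, n)\<in>I. B z n)" using z(1) by (auto simp: I_def)
      qed
    qed
    moreover have "(\<Union>(z, n)\<in>I. B z n) \<in> sigma_sets C (Collect open_upper)"
      using \<open>countable I\<close> B by (intro sigma_sets_UNION) auto
    ultimately show ?thesis by simp
  qed
  have "sets (restrict_space borel C) = (\<inter>) C ` sigma_sets UNIV (Collect open)"
    by (simp add: sets_restrict_space borel_def)
  also have "\<dots> = sigma_sets C ((\<inter>) C ` Collect open)"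
    using open_C by (intro sigma_sets_Int) auto
  also have "\<dots> \<subseteq> sigma_sets C (Collect open_upper)"
    using open_C open_sigma by (intro sigma_sets_mono) auto
  finally show "sets (restrict_space borel C) \<subseteq> sigma_sets C (Collect open_upper)" .
qed

lemma stoch_le_antisym:
  assumes M: "M \<in> prob_measures_on C" and N: "N \<in> prob_measures_on C"
    and "stoch_le C M N" "stoch_le C N M"
  shows "M = N"
proof (rule measure_eqI_generator_eq[where \<Omega> = C and E = "Collect open_upper" and A = "\<lambda>_. C"])
  interpret M: prob_space M using M by (rule prob_measures_onD)
  interpret N: prob_space N using N by (rule prob_measures_onD)
  show "Int_stable (Collect open_upper)" by (auto simp: Int_stable_def open_upper_Int)
  show "Collect open_upper \<subseteq> Pow C" by (auto simp: open_upper_iff)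
  show "emeasure M U = emeasure N U" if "U \<in> Collect open_upper" for U
    using that assms(3,4) by (auto simp: stoch_le_iff M.emeasure_eq_measure N.emeasure_eq_measure intro: antisym)
  show "sets M = sigma_sets C (Collect open_upper)" "sets N = sigma_sets C (Collect open_upper)"
    using prob_measures_onD(2)[OF M] prob_measures_onD(2)[OF N] by (simp_all add: sigma_sets_open_upper)
  show "emeasure M C \<noteq> \<infinity>" by simp
qed (auto simp: open_upper_C)

section \<open>From subsequences to the whole sequence\<close>

text \<open>The assumption \<open>unique\<close> is a single inequality, but it quantifies over all
  ordered pairs of subsequences; exchanging the two limits and using antisymmetry turns it into
  equality.\<close>

lemma weakly_converges_if_unique_limit_point:
  assumes \<alpha>: "\<alpha> \<in> prob_measures_on C" and \<beta>: "\<beta> \<in> prob_measures_on C"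
    and M: "\<And>n::nat. M n \<in> prob_measures_on C"
    and le: "\<And>n. stoch_le C \<alpha> (M n)" "\<And>n. stoch_le C (M n) \<beta>"
    and unique: "\<And>r r' \<mu> \<mu>'. strict_mono r \<Longrightarrow> strict_mono r' \<Longrightarrow> \<mu> \<in> prob_measures_on C \<Longrightarrow>
      \<mu>' \<in> prob_measures_on C \<Longrightarrow> weakly_converges C (M \<circ> r) \<mu> \<Longrightarrow> weakly_converges C (M \<circ> r') \<mu>' \<Longrightarrow>
      stoch_le C \<mu> \<mu>'"
  shows "\<exists>\<mu>\<in>prob_measures_on C. weakly_converges C M \<mu>"
proof -
  obtain r \<mu> where r: "strict_mono r" and \<mu>: "\<mu> \<in> prob_measures_on C" and w: "weakly_converges C (M \<circ> r) \<mu>"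
    using order_interval_sequentially_compact[OF \<alpha> \<beta>, of M] M le by blast
  have "weakly_converges C M \<mu>"
    unfolding weakly_converges_def
  proof (intro allI impI, rule ccontr)
    fix f :: "'a \<Rightarrow> real" assume f: "continuous_on C f \<and> bounded (f ` C)"
      and "\<not> (\<lambda>n. integral\<^sup>L (M n) f) \<longlonglongrightarrow> integral\<^sup>L \<mu> f"
    then obtain \<epsilon> where \<epsilon>: "\<epsilon> > 0" and
      "\<not> (\<forall>\<^sub>F n in sequentially. dist (integral\<^sup>L (M n) f) (integral\<^sup>L \<mu> f) < \<epsilon>)"
      unfolding tendsto_iff by blast
    then have "infinite {n. \<not> dist (integral\<^sup>L (M n) f) (integral\<^sup>L \<mu> f) < \<epsilon>}"
      by (simp add: eventually_cofinite[symmetric] cofinite_eq_sequentially)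
    \<comment> \<open>The subsequence \<open>q\<close> keeps a distance \<open>\<epsilon>\<close>
      from the limit for one fixed \<open>f\<close>; compactness gives it a convergent subsequence,
      whose limit must again be \<open>\<mu>\<close>.\<close>
    then obtain q :: "nat \<Rightarrow> nat" where q: "strict_mono q"
      "\<And>n. \<not> dist (integral\<^sup>L (M (q n)) f) (integral\<^sup>L \<mu> f) < \<epsilon>"
      using infinite_enumerate by blast
    obtain r' \<mu>' where r': "strict_mono r'" and \<mu>': "\<mu>' \<in> prob_measures_on C"
      and w': "weakly_converges C (M \<circ> q \<circ> r') \<mu>'"
      using order_interval_sequentially_compact[OF \<alpha> \<beta>, of "M \<circ> q"] M le by auto
    have qr: "strict_mono (q \<circ> r')" using q(1) r' by (rule strict_mono_o)
    have w'': "weakly_converges C (M \<circ> (q \<circ> r')) \<mu>'" using w' by (simp add: comp_assoc)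
    have "\<mu>' = \<mu>"
      using unique[OF r qr \<mu> \<mu>' w w''] unique[OF qr r \<mu>' \<mu> w'' w] stoch_le_antisym[OF \<mu>' \<mu>] by blast
    then have "(\<lambda>n. integral\<^sup>L (M (q (r' n))) f) \<longlonglongrightarrow> integral\<^sup>L \<mu> f"
      using w' f by (simp add: weakly_converges_def)
    then have "\<forall>\<^sub>F n in sequentially. dist (integral\<^sup>L (M (q (r' n))) f) (integral\<^sup>L \<mu> f) < \<epsilon>"
      using \<epsilon> by (rule tendstoD)
    then show False using q(2) by simp
  qed
  then show ?thesis using \<mu> by (rule bexI)
qed

section \<open>Monotone sequences\<close>

lemma stoch_le_refl: "stoch_le C M M"
  by (simp add: stoch_le_iff)

lemma stoch_le_trans: "stoch_le C L M \<Longrightarrow> stoch_le C M N \<Longrightarrow> stoch_le C L N"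
  unfolding stoch_le_iff using order_trans by blast

lemma increasing_sequence_converges:
  assumes M: "\<And>n::nat. M n \<in> prob_measures_on C" and \<nu>: "\<nu> \<in> prob_measures_on C"
    and step: "\<And>n. stoch_le C (M n) (M (Suc n))" and le: "\<And>n. stoch_le C (M n) \<nu>"
  shows "\<exists>\<mu>\<in>prob_measures_on C.
    (\<forall>n. stoch_le C (M n) \<mu>) \<and> stoch_le C \<mu> \<nu> \<and> weakly_converges C M \<mu>"
proof -
  have mono: "stoch_le C (M m) (M n)" if "m \<le> n" for m n
    using that by (induction rule: dec_induct) (auto intro: stoch_le_refl stoch_le_trans step)
  have lower: "stoch_le C (M m) \<mu>"
    if "strict_mono r" "\<mu> \<in> prob_measures_on C" "weakly_converges C (M \<circ> r) \<mu>" for r \<mu> m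
  proof (rule stoch_le_weak_limit[OF M _ that(2,3)])
    have "stoch_le C (M m) (M (r n))" if "m \<le> n" for n
      using mono seq_suble[OF \<open>strict_mono r\<close>, of n] that by (meson le_trans)
    then show "\<forall>\<^sub>F n in sequentially. stoch_le C (M m) ((M \<circ> r) n)"
      by (auto simp: eventually_sequentially)
  qed (simp add: M)
  \<comment> \<open>The limit \<open>\<mu>'\<close> dominates every term, in particular those of the
    subsequence converging to \<open>\<mu>\<close>, and this bound passes to
    \<open>\<mu>\<close>.\<close>
  have unique: "stoch_le C \<mu> \<mu>'"
    if "strict_mono r" "strict_mono r'" "\<mu> \<in> prob_measures_on C" "\<mu>' \<in> prob_measures_on C"
      "weakly_converges C (M \<circ> r) \<mu>" "weakly_converges C (M \<circ> r') \<mu>'" for r r' \<mu> \<mu>'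
    using lower[OF that(2,4,6)] by (intro weak_limit_stoch_le[OF that(4) _ that(3,5)]) (auto simp: M)
  \<comment> \<open>The order interval containing the sequence runs from \<open>M 0\<close> to
    \<open>\<nu>\<close>.\<close>
  have "\<exists>\<mu>\<in>prob_measures_on C. weakly_converges C M \<mu>"
    using M[of 0] \<nu> M mono[OF le0] le unique by (rule weakly_converges_if_unique_limit_point)
  then obtain \<mu> where \<mu>: "\<mu> \<in> prob_measures_on C" "weakly_converges C M \<mu>" by blast
  show ?thesis
  proof (intro bexI[OF _ \<mu>(1)] conjI allI \<mu>(2))
    show "stoch_le C (M n) \<mu>" for n using lower[of id] \<mu> by (simp add: strict_mono_id)
    show "stoch_le C \<mu> \<nu>" using le by (intro weak_limit_stoch_le[OF \<nu> M \<mu>]) auto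
  qed
qed

lemma decreasing_sequence_converges:
  assumes M: "\<And>n::nat. M n \<in> prob_measures_on C" and \<nu>: "\<nu> \<in> prob_measures_on C"
    and step: "\<And>n. stoch_le C (M (Suc n)) (M n)" and le: "\<And>n. stoch_le C \<nu> (M n)"
  shows "\<exists>\<mu>\<in>prob_measures_on C.
    (\<forall>n. stoch_le C \<mu> (M n)) \<and> stoch_le C \<nu> \<mu> \<and> weakly_converges C M \<mu>"
proof -
  have mono: "stoch_le C (M n) (M m)" if "m \<le> n" for m n
    using that by (induction rule: dec_induct) (auto intro: stoch_le_refl stoch_le_trans step)
  have upper: "stoch_le C \<mu> (M m)"
    if "strict_mono r" "\<mu> \<in> prob_measures_on C" "weakly_converges C (M \<circ> r) \<mu>" for r \<mu> m
  proof (rule weak_limit_stoch_le[OF M _ that(2,3)])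
    have "stoch_le C (M (r n)) (M m)" if "m \<le> n" for n
      using mono seq_suble[OF \<open>strict_mono r\<close>, of n] that by (meson le_trans)
    then show "\<forall>\<^sub>F n in sequentially. stoch_le C ((M \<circ> r) n) (M m)"
      by (auto simp: eventually_sequentially)
  qed (simp add: M)
  \<comment> \<open>Here \<open>\<mu>\<close> is the common bound: it lies below every term, hence
    below the limit \<open>\<mu>'\<close> of the second subsequence.\<close>
  have unique: "stoch_le C \<mu> \<mu>'"
    if "strict_mono r" "strict_mono r'" "\<mu> \<in> prob_measures_on C" "\<mu>' \<in> prob_measures_on C"
      "weakly_converges C (M \<circ> r) \<mu>" "weakly_converges C (M \<circ> r') \<mu>'" for r r' \<mu> \<mu>'
    using upper[OF that(1,3,5)] by (intro stoch_le_weak_limit[OF that(3) _ that(4,6)]) (auto simp: M)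
  have "\<exists>\<mu>\<in>prob_measures_on C. weakly_converges C M \<mu>"
    using \<nu> M[of 0] M le mono[OF le0] unique by (rule weakly_converges_if_unique_limit_point)
  then obtain \<mu> where \<mu>: "\<mu> \<in> prob_measures_on C" "weakly_converges C M \<mu>" by blast
  show ?thesis
  proof (intro bexI[OF _ \<mu>(1)] conjI allI \<mu>(2))
    show "stoch_le C \<mu> (M n)" for n using upper[of id] \<mu> by (simp add: strict_mono_id)
    show "stoch_le C \<nu> \<mu>" using le by (intro stoch_le_weak_limit[OF \<nu> M \<mu>]) auto
  qed
qed

end

theorem proposition6p3:
  fixes C :: "'a::banach set"
    and M :: "nat \<Rightarrow> 'a measure"
    and \<nu> :: "'a measure"
  assumes "\<exists>B :: 'a set. finite B \<and> span B = UNIV"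
    and "open_cone C"
    and "proper_cone (closure C)"
    and "\<And>n. M n \<in> prob_measures_on C"
    and "\<nu> \<in> prob_measures_on C"
  shows "((\<forall>n. stoch_le C (M n) (M (Suc n))) \<and> (\<forall>n. stoch_le C (M n) \<nu>) \<longrightarrow>
            (\<exists>\<mu>\<in>prob_measures_on C.
               (\<forall>n. stoch_le C (M n) \<mu>) \<and> stoch_le C \<mu> \<nu> \<and> weakly_converges C M \<mu>)) \<and>
         ((\<forall>n. stoch_le C (M (Suc n)) (M n)) \<and> (\<forall>n. stoch_le C \<nu> (M n)) \<longrightarrow>
            (\<exists>\<mu>\<in>prob_measures_on C.
               (\<forall>n. stoch_le C \<mu> (M n)) \<and> stoch_le C \<nu> \<mu> \<and> weakly_converges C M \<mu>))"
proof -
  interpret proper_open_cone C using assms(1-3) by unfold_locales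
  show ?thesis
  proof (intro conjI impI; elim conjE)
    assume "\<forall>n. stoch_le C (M n) (M (Suc n))" "\<forall>n. stoch_le C (M n) \<nu>"
    then show "\<exists>\<mu>\<in>prob_measures_on C.
        (\<forall>n. stoch_le C (M n) \<mu>) \<and> stoch_le C \<mu> \<nu> \<and> weakly_converges C M \<mu>"
      by (intro increasing_sequence_converges assms(4,5)) simp_all
  next
    assume "\<forall>n. stoch_le C (M (Suc n)) (M n)" "\<forall>n. stoch_le C \<nu> (M n)"
    then show "\<exists>\<mu>\<in>prob_measures_on C.
        (\<forall>n. stoch_le C \<mu> (M n)) \<and> stoch_le C \<nu> \<mu> \<and> weakly_converges C M \<mu>"
      by (intro decreasing_sequence_converges assms(4,5)) simp_all
  qed
qed

end
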